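(* Assume that for any two vertices $v_i,v_j$ the distance $|v_iv_j|$ can be obtained in $O(1)$ time. Then the radius-optimally augmenting path problem can be solved in $O(n)$ time: one can compute, in $O(n)$ time, a pair of indices $(i,j)$ with $1\le i\le j\le n$ minimizing the radius of $G(i,j)$ over all such pairs, together with that radius and a center of $G(i,j)$.
   Context: Let $v_1,\dots,v_n$ be points of a metric space with metric $|\cdot|$: $|v_iv_j|=|v_jv_i|\ge 0$, $|v_iv_j|=0$ iff $i=j$, and $|v_iv_k|+|v_kv_j|\ge |v_iv_j|$. $P$ is the path graph with vertices $v_1,\dots,v_n$ and edges $e(v_k,v_{k+1})$, $k\in[1,n-1]$, where $e(v_k,v_{k+1})$ has length $|v_kv_{k+1}|$. For $1\le i\le j\le n$, $G(i,j)=P\cup\{e(v_i,v_j)\}$ is obtained from $P$ by adding an edge $e(v_i,v_j)$ of length $|v_iv_j|$ (if $j\le i+1$ then $G(i,j)=P$). Graphs are regarded as metric graphs: a point of a graph is either a vertex or a point in the interior of an edge, with distances along an edge measured proportionally to its length; $d_G(p,q)$ is the length of a shortest path between points $p,q$ in $G$. A center of $G$ is a point of $G$ minimizing the maximum of $d_G(\cdot,v)$ over all vertices $v$ of $G$, and this minimum value is the radius of $G$. *)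

theory Defs
  imports Main "HOL.Real"
begin

definition adjG :: "nat \<Rightarrow> nat \<Rightarrow> nat \<Rightarrow> nat \<Rightarrow> nat \<Rightarrow> bool" where
  "adjG n i j a b \<longleftrightarrow> 1 \<le> a \<and> a \<le> n \<and> 1 \<le> b \<and> b \<le> n \<and>
     (b = a + 1 \<or> a = b + 1 \<or> (i + 1 < j \<and> {a, b} = {i, j}))"

definition walk_len :: "(nat \<Rightarrow> nat \<Rightarrow> real) \<Rightarrow> nat list \<Rightarrow> real" where
  "walk_len d xs = (\<Sum>k < length xs - 1. d (xs ! k) (xs ! Suc k))"

definition is_walk :: "nat \<Rightarrow> nat \<Rightarrow> nat \<Rightarrow> nat list \<Rightarrow> nat \<Rightarrow> nat \<Rightarrow> bool" where
  "is_walk n i j xs a b \<longleftrightarrow> xs \<noteq> [] \<and> hd xs = a \<and> last xs = b \<and>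
     (\<forall>k < length xs - 1. adjG n i j (xs ! k) (xs ! Suc k))"

definition gdist :: "nat \<Rightarrow> (nat \<Rightarrow> nat \<Rightarrow> real) \<Rightarrow> nat \<Rightarrow> nat \<Rightarrow> nat \<Rightarrow> nat \<Rightarrow> real" where
  "gdist n d i j a b = Inf {walk_len d xs | xs. is_walk n i j xs a b}"

text \<open>A point of G(i,j) is encoded as (a,b,t): either the vertex a (t = 0),
  or the point in the interior of edge e(v_a,v_b) at distance t from v_a
  (0 < t < |v_a v_b|).\<close>
type_synonym gpoint = "nat \<times> nat \<times> real"

definition is_point :: "nat \<Rightarrow> (nat \<Rightarrow> nat \<Rightarrow> real) \<Rightarrow> nat \<Rightarrow> nat \<Rightarrow> gpoint \<Rightarrow> bool" where
  "is_point n d i j p = (case p of (a, b, t) \<Rightarrow>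
     (t = 0 \<and> 1 \<le> a \<and> a \<le> n) \<or> (adjG n i j a b \<and> 0 < t \<and> t < d a b))"

definition pdist :: "nat \<Rightarrow> (nat \<Rightarrow> nat \<Rightarrow> real) \<Rightarrow> nat \<Rightarrow> nat \<Rightarrow> gpoint \<Rightarrow> nat \<Rightarrow> real" where
  "pdist n d i j p v = (case p of (a, b, t) \<Rightarrow>
     (if t = 0 then gdist n d i j a v
      else min (t + gdist n d i j a v) (d a b - t + gdist n d i j b v)))"

definition ecc :: "nat \<Rightarrow> (nat \<Rightarrow> nat \<Rightarrow> real) \<Rightarrow> nat \<Rightarrow> nat \<Rightarrow> gpoint \<Rightarrow> real" where
  "ecc n d i j p = Max ((\<lambda>v. pdist n d i j p v) ` {1..n})"

definition radius :: "nat \<Rightarrow> (nat \<Rightarrow> nat \<Rightarrow> real) \<Rightarrow> nat \<Rightarrow> nat \<Rightarrow> real" where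
  "radius n d i j = Inf (ecc n d i j ` {p. is_point n d i j p})"

definition is_center :: "nat \<Rightarrow> (nat \<Rightarrow> nat \<Rightarrow> real) \<Rightarrow> nat \<Rightarrow> nat \<Rightarrow> gpoint \<Rightarrow> bool" where
  "is_center n d i j p \<longleftrightarrow> is_point n d i j p \<and> ecc n d i j p = radius n d i j"

definition is_finite_metric :: "nat \<Rightarrow> (nat \<Rightarrow> nat \<Rightarrow> real) \<Rightarrow> bool" where
  "is_finite_metric n d \<longleftrightarrow>
     (\<forall>a\<in>{1..n}. \<forall>b\<in>{1..n}. d a b = d b a \<and> d a b \<ge> 0 \<and> (d a b = 0 \<longleftrightarrow> a = b)) \<and>
     (\<forall>a\<in>{1..n}. \<forall>b\<in>{1..n}. \<forall>c\<in>{1..n}. d a c + d c b \<ge> d a b)"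

text \<open>Integer memory and real memory, both indexed by natural addresses.
  Unit-cost operations: integer +,-, comparisons; real +,-,*,/, comparisons;
  conversion int->real; one dist_oracle call Dist i j returning |v_i v_j|.
  Each executed statement (and each loop test) costs one time unit; expressions
  are of constant size in a fixed program.\<close>

type_synonym state = "(nat \<Rightarrow> int) \<times> (nat \<Rightarrow> real)"

datatype aexp = N int | Mem aexp | Plus aexp aexp | Minus aexp aexp

datatype rexp = RMem aexp | OfInt aexp | RPlus rexp rexp | RMinus rexp rexp
  | RTimes rexp rexp | RDiv rexp rexp | Dist aexp aexp

datatype bexp = ILess aexp aexp | IEq aexp aexp | RLess rexp rexp | REq rexp rexp
  | BNot bexp | BAnd bexp bexp

datatype com = SKIP | IStore aexp aexp | RStore aexp rexp | Seq com com
  | If bexp com com | While bexp com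

fun aval :: "aexp \<Rightarrow> state \<Rightarrow> int" where
  "aval (N c) s = c"
| "aval (Mem e) s = fst s (nat (aval e s))"
| "aval (Plus e1 e2) s = aval e1 s + aval e2 s"
| "aval (Minus e1 e2) s = aval e1 s - aval e2 s"

fun rval :: "(int \<Rightarrow> int \<Rightarrow> real) \<Rightarrow> rexp \<Rightarrow> state \<Rightarrow> real" where
  "rval D (RMem e) s = snd s (nat (aval e s))"
| "rval D (OfInt e) s = real_of_int (aval e s)"
| "rval D (RPlus e1 e2) s = rval D e1 s + rval D e2 s"
| "rval D (RMinus e1 e2) s = rval D e1 s - rval D e2 s"
| "rval D (RTimes e1 e2) s = rval D e1 s * rval D e2 s"
| "rval D (RDiv e1 e2) s = rval D e1 s / rval D e2 s"
| "rval D (Dist e1 e2) s = D (aval e1 s) (aval e2 s)"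

fun bval :: "(int \<Rightarrow> int \<Rightarrow> real) \<Rightarrow> bexp \<Rightarrow> state \<Rightarrow> bool" where
  "bval D (ILess e1 e2) s = (aval e1 s < aval e2 s)"
| "bval D (IEq e1 e2) s = (aval e1 s = aval e2 s)"
| "bval D (RLess e1 e2) s = (rval D e1 s < rval D e2 s)"
| "bval D (REq e1 e2) s = (rval D e1 s = rval D e2 s)"
| "bval D (BNot b) s = (\<not> bval D b s)"
| "bval D (BAnd b1 b2) s = (bval D b1 s \<and> bval D b2 s)"

inductive exec :: "(int \<Rightarrow> int \<Rightarrow> real) \<Rightarrow> com \<Rightarrow> state \<Rightarrow> nat \<Rightarrow> state \<Rightarrow> bool" where
  Skip: "exec D SKIP s 1 s"
| IStore: "exec D (IStore a e) s 1 ((fst s)(nat (aval a s) := aval e s), snd s)"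
| RStore: "exec D (RStore a e) s 1 (fst s, (snd s)(nat (aval a s) := rval D e s))"
| Seq: "exec D c1 s k1 s' \<Longrightarrow> exec D c2 s' k2 s'' \<Longrightarrow> exec D (Seq c1 c2) s (k1 + k2) s''"
| IfT: "bval D b s \<Longrightarrow> exec D c1 s k t \<Longrightarrow> exec D (If b c1 c2) s (Suc k) t"
| IfF: "\<not> bval D b s \<Longrightarrow> exec D c2 s k t \<Longrightarrow> exec D (If b c1 c2) s (Suc k) t"
| WhileF: "\<not> bval D b s \<Longrightarrow> exec D (While b c) s 1 s"
| WhileT: "bval D b s \<Longrightarrow> exec D c s k1 s' \<Longrightarrow> exec D (While b c) s' k2 s''
           \<Longrightarrow> exec D (While b c) s (Suc (k1 + k2)) s''"

definition dist_oracle :: "nat \<Rightarrow> (nat \<Rightarrow> nat \<Rightarrow> real) \<Rightarrow> int \<Rightarrow> int \<Rightarrow> real" where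
  "dist_oracle n d i j = (if 1 \<le> i \<and> i \<le> int n \<and> 1 \<le> j \<and> j \<le> int n then d (nat i) (nat j) else 0)"

definition init :: "nat \<Rightarrow> state" where
  "init n = ((\<lambda>_. 0)(0 := int n), (\<lambda>_. 0))"

definition correct_output :: "nat \<Rightarrow> (nat \<Rightarrow> nat \<Rightarrow> real) \<Rightarrow> state \<Rightarrow> bool" where
  "correct_output n d s \<longleftrightarrow>
     (let i = nat (fst s 0); j = nat (fst s 1) in
        1 \<le> fst s 0 \<and> i \<le> j \<and> j \<le> n \<and>
        (\<forall>i' j'. 1 \<le> i' \<and> i' \<le> j' \<and> j' \<le> n \<longrightarrow> radius n d i j \<le> radius n d i' j') \<and>
        snd s 0 = radius n d i j \<and>
        0 \<le> fst s 2 \<and> 0 \<le> fst s 3 \<and>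
        is_center n d i j (nat (fst s 2), nat (fst s 3), snd s 1))"

end

(* A center of G(i,j) has a shortest-path tree that omits the new edge or one path edge
   (v_m, v_{m+1}) with i <= m < j. So twice the optimal radius is the minimum of |P| and of the
   diameters of the trees obtained by joining the paths v_1..v_m and v_{m+1}..v_n with an edge
   (v_i, v_j). By the triangle inequality, for fixed m the endpoints v_i and v_j can be moved to one
   of the two vertices around the midpoint of their respective paths, which leaves four candidates
   for every m. Both midpoints move monotonically with m, so two pointers find all the candidates in
   linear time. *)

theory Submission
  imports Defs
begin

text \<open>That the infimum in \<open>radius\<close> is attained is not argued by compactness.
  Every point of every G(i,j), center or not, has eccentricity at least half of |P| or half of some
  tree diameter. Conversely, a point is exhibited whose eccentricity is at most half of the smallest
  of these numbers: the midpoint of a longest path in the corresponding tree, which is a subgraph,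
  so that distances in G(i,j) can only be shorter. All this becomes arithmetic with the coordinate
  \<open>X k\<close> of v_k along P once the infimum over walks in \<open>gdist\<close> is replaced
  by the minimum over three routes. The search compares diameters, so halving is left to the end.
  The midpoint follows in constant time from the eccentricities \<open>A\<close> and
  \<open>B\<close> of the ends of the new edge within their own components. A midpoint on P is then
  known only by its coordinate, and one final walk along P finds the edge that contains it.\<close>

locale metric_path =
  fixes n :: nat and d :: "nat \<Rightarrow> nat \<Rightarrow> real"
  assumes n_pos: "1 \<le> n" and metric: "is_finite_metric n d"
begin

section \<open>Coordinates of the vertices along P\<close>

definition X :: "nat \<Rightarrow> real" where
  "X k = (\<Sum>l = 1..<k. d l (Suc l))"

lemma X_1 [simp]: "X (Suc 0) = 0"
  by (simp add: X_def)

lemma X_Suc: "1 \<le> k \<Longrightarrow> X (Suc k) = X k + d k (Suc k)"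
  by (simp add: X_def)

lemma d_self: "1 \<le> a \<Longrightarrow> a \<le> n \<Longrightarrow> d a a = 0"
  and d_sym: "1 \<le> a \<Longrightarrow> a \<le> n \<Longrightarrow> 1 \<le> b \<Longrightarrow> b \<le> n \<Longrightarrow> d a b = d b a"
  and d_nonneg: "1 \<le> a \<Longrightarrow> a \<le> n \<Longrightarrow> 1 \<le> b \<Longrightarrow> b \<le> n \<Longrightarrow> 0 \<le> d a b"
  and d_pos: "1 \<le> a \<Longrightarrow> a \<le> n \<Longrightarrow> 1 \<le> b \<Longrightarrow> b \<le> n \<Longrightarrow> a \<noteq> b \<Longrightarrow> 0 < d a b"
  and d_triangle: "1 \<le> a \<Longrightarrow> a \<le> n \<Longrightarrow> 1 \<le> b \<Longrightarrow> b \<le> n \<Longrightarrow> 1 \<le> c \<Longrightarrow> c \<le> n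
    \<Longrightarrow> d a b \<le> d a c + d c b"
  using metric unfolding is_finite_metric_def by (auto simp: less_le)

lemma X_mono: "1 \<le> a \<Longrightarrow> a \<le> b \<Longrightarrow> b \<le> n \<Longrightarrow> X a \<le> X b"
proof (induction b)
  case (Suc b)
  show ?case
  proof (cases "a = Suc b")
    case False
    then have "X a \<le> X b" using Suc by auto
    then show ?thesis using X_Suc[of b] d_nonneg[of b "Suc b"] Suc.prems False by auto
  qed simp
qed simp

lemma X_strict: "1 \<le> a \<Longrightarrow> a < b \<Longrightarrow> b \<le> n \<Longrightarrow> X a < X b"
  using X_mono[of "Suc a" b] X_Suc[of a] d_pos[of a "Suc a"] by auto

lemma X_nonneg: "1 \<le> a \<Longrightarrow> a \<le> n \<Longrightarrow> 0 \<le> X a"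
  using X_mono[of 1 a] by simp

lemma X_le_last: "1 \<le> a \<Longrightarrow> a \<le> n \<Longrightarrow> X a \<le> X n"
  using X_mono[of a n] by simp

lemma d_le_X: "1 \<le> a \<Longrightarrow> a \<le> b \<Longrightarrow> b \<le> n \<Longrightarrow> d a b \<le> X b - X a"
proof (induction b)
  case (Suc b)
  show ?case
  proof (cases "a = Suc b")
    case True
    then show ?thesis using d_self[of a] Suc.prems by auto
  next
    case False
    then have "d a b \<le> X b - X a" using Suc by auto
    then show ?thesis using X_Suc[of b] d_triangle[of a "Suc b" b] Suc.prems False by auto
  qed
qed simp

section \<open>Distances in the augmented path\<close>

text \<open>A shortest route crosses the new edge at most once, in one of two directions, which
  leaves three routes from coordinate \<open>y\<close> to vertex \<open>v\<close>. The formula also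
  fits j \<le> i + 1, where the two detours are no shorter than the direct route.\<close>

definition path_dist :: "nat \<Rightarrow> nat \<Rightarrow> real \<Rightarrow> nat \<Rightarrow> real" where
  "path_dist i j y v = min \<bar>y - X v\<bar>
     (min (\<bar>y - X i\<bar> + d i j + \<bar>X j - X v\<bar>) (\<bar>y - X j\<bar> + d i j + \<bar>X i - X v\<bar>))"

lemma path_dist_le_iff: "path_dist i j y v \<le> r \<longleftrightarrow> \<bar>y - X v\<bar> \<le> r
    \<or> \<bar>y - X i\<bar> + d i j + \<bar>X j - X v\<bar> \<le> r \<or> \<bar>y - X j\<bar> + d i j + \<bar>X i - X v\<bar> \<le> r"
  unfolding path_dist_def by (simp add: min_le_iff_disj)

lemma le_path_dist_iff: "r \<le> path_dist i j y v \<longleftrightarrow> r \<le> \<bar>y - X v\<bar>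
    \<and> r \<le> \<bar>y - X i\<bar> + d i j + \<bar>X j - X v\<bar> \<and> r \<le> \<bar>y - X j\<bar> + d i j + \<bar>X i - X v\<bar>"
  unfolding path_dist_def by simp

lemma walk_len_Cons: "walk_len d (a # b # xs) = d a b + walk_len d (b # xs)"
  unfolding walk_len_def by (simp add: sum.lessThan_Suc_shift del: sum.lessThan_Suc)

lemma walk_len_single [simp]: "walk_len d [a] = 0"
  by (simp add: walk_len_def)

lemma is_walk_Cons:
  "is_walk n i j (a # b # xs) c e \<longleftrightarrow> a = c \<and> adjG n i j a b \<and> is_walk n i j (b # xs) b e"
  unfolding is_walk_def by (auto simp: all_conj_distrib less_Suc_eq_0_disj)

lemma is_walk_single: "is_walk n i j [a] c e \<longleftrightarrow> a = c \<and> a = e"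
  unfolding is_walk_def by auto

context
  fixes i j :: nat
  assumes ij: "1 \<le> i" "i \<le> j" "j \<le> n"
begin

lemma path_dist_edge:
  assumes "adjG n i j a b"
  shows "path_dist i j (X a) v \<le> d a b + path_dist i j (X b) v"
proof -
  have ab: "1 \<le> a" "a \<le> n" "1 \<le> b" "b \<le> n" using assms unfolding adjG_def by auto
  consider (path) "\<bar>X a - X b\<bar> = d a b" | (new) "{a, b} = {i, j}"
    using assms X_Suc[of a] X_Suc[of b] d_sym[of a b] d_nonneg[of a b] ab
    unfolding adjG_def by fastforce
  moreover have "path_dist i j (X a) v \<le> path_dist i j (X a) v" by simp
  note bounds = this[unfolded le_path_dist_iff]
  ultimately have "path_dist i j (X a) v - d a b \<le> path_dist i j (X b) v"
  proof cases
    case path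
    then show ?thesis unfolding le_path_dist_iff using bounds by auto
  next
    case new
    have "0 \<le> d i j" "d j i = d i j" using d_nonneg d_sym ij by auto
    then show ?thesis
      using new bounds unfolding le_path_dist_iff doubleton_eq_iff by auto
  qed
  then show ?thesis by simp
qed

lemma path_dist_le_walk:
  "is_walk n i j xs a b \<Longrightarrow> path_dist i j (X a) b \<le> walk_len d xs"
proof (induction xs arbitrary: a)
  case Nil
  then show ?case by (simp add: is_walk_def)
next
  case (Cons x xs)
  show ?case
  proof (cases xs)
    case Nil
    then show ?thesis using Cons.prems by (auto simp: is_walk_single path_dist_def min_le_iff_disj)
  next
    case (Cons y ys)
    then show ?thesis
      using Cons.prems Cons.IH[of y] path_dist_edge[of x y b]
      by (auto simp: is_walk_Cons walk_len_Cons)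
  qed
qed

lemma walk_Cons_ex:
  assumes "\<exists>xs. is_walk n i j xs b c \<and> walk_len d xs = l" "adjG n i j a b"
  shows "\<exists>xs. is_walk n i j xs a c \<and> walk_len d xs = d a b + l"
proof -
  obtain xs where xs: "is_walk n i j xs b c" "walk_len d xs = l" using assms by blast
  then obtain ys where "xs = b # ys" unfolding is_walk_def by (cases xs) auto
  then have "is_walk n i j (a # xs) a c \<and> walk_len d (a # xs) = d a b + l"
    using xs assms by (simp add: is_walk_Cons walk_len_Cons)
  then show ?thesis by blast
qed

lemma walk_along_path:
  assumes "\<exists>xs. is_walk n i j xs b c \<and> walk_len d xs = l"
    "1 \<le> a" "a \<le> n" "1 \<le> b" "b \<le> n"
  shows "\<exists>xs. is_walk n i j xs a c \<and> walk_len d xs = \<bar>X a - X b\<bar> + l"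
proof (cases "a \<le> b")
  case True
  then show ?thesis using assms(2)
  proof (induction a rule: inc_induct)
    case base
    then show ?case using assms by simp
  next
    case (step k)
    have "adjG n i j k (Suc k)" using step assms by (simp add: adjG_def)
    from walk_Cons_ex[OF step.IH this] step show ?case
      using X_Suc[of k] X_mono[of "Suc k" b] d_nonneg[of k "Suc k"] assms by auto
  qed
next
  case False
  then have "b \<le> a" by simp
  then show ?thesis using assms(3)
  proof (induction a rule: dec_induct)
    case base
    then show ?case using assms by simp
  next
    case (step k)
    have "adjG n i j (Suc k) k" using step assms by (simp add: adjG_def)
    from walk_Cons_ex[OF step.IH this] step show ?case
      using X_Suc[of k] X_mono[of b k] d_nonneg[of k "Suc k"] d_sym[of k "Suc k"] assms
      by auto
  qed
qed

lemma gdist_le_walk: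
  assumes "\<exists>xs. is_walk n i j xs a b \<and> walk_len d xs = l"
  shows "gdist n d i j a b \<le> l"
  unfolding gdist_def using assms path_dist_le_walk
  by (auto intro!: cInf_lower bdd_belowI[where m = "path_dist i j (X a) b"])

lemma walk_refl: "\<exists>xs. is_walk n i j xs a a \<and> walk_len d xs = 0"
  by (rule exI[of _ "[a]"]) (simp add: is_walk_single)

lemma gdist_eq:
  assumes "1 \<le> a" "a \<le> n" "1 \<le> v" "v \<le> n"
  shows "gdist n d i j a v = path_dist i j (X a) v"
proof (rule antisym)
  have 1: "gdist n d i j a v \<le> \<bar>X a - X v\<bar>"
    using gdist_le_walk[OF walk_along_path[OF walk_refl, of a v]] assms by simp
  have 2: "gdist n d i j a v \<le> \<bar>X a - X i\<bar> + d i j + \<bar>X j - X v\<bar>"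
      "gdist n d i j a v \<le> \<bar>X a - X j\<bar> + d i j + \<bar>X i - X v\<bar>" if "i < j"
  proof -
    \<comment> \<open>For j = i + 1 this is a path edge, for larger j the added one.\<close>
    have adj: "adjG n i j i j" "adjG n i j j i" using that ij by (auto simp: adjG_def)
    show "gdist n d i j a v \<le> \<bar>X a - X i\<bar> + d i j + \<bar>X j - X v\<bar>"
      using gdist_le_walk[OF walk_along_path[OF walk_Cons_ex[OF
          walk_along_path[OF walk_refl, of j v] adj(1)], of a]] assms ij by simp
    show "gdist n d i j a v \<le> \<bar>X a - X j\<bar> + d i j + \<bar>X i - X v\<bar>"
      using gdist_le_walk[OF walk_along_path[OF walk_Cons_ex[OF
          walk_along_path[OF walk_refl, of i v] adj(2)], of a]] assms ij d_sym[of i j] by simp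
  qed
  show "gdist n d i j a v \<le> path_dist i j (X a) v"
  proof (cases "i < j")
    case True
    then show ?thesis using 1 2 unfolding path_dist_def by simp
  next
    case False
    then have "i = j" using ij by simp
    then show ?thesis using 1 d_self[of j] ij unfolding path_dist_def by simp
  qed
  show "path_dist i j (X a) v \<le> gdist n d i j a v"
    unfolding gdist_def
  proof (rule cInf_greatest)
    show "{walk_len d xs |xs. is_walk n i j xs a v} \<noteq> {}"
      using walk_along_path[OF walk_refl, of a v] assms by auto
  qed (use path_dist_le_walk in auto)
qed

text \<open>No vertex lies strictly between v_a and its successor, so each |y - X z| is the shorter
  of the two ways out of the edge (\<open>split\<close>). The minimum over the two ends then
  distributes over the three routes (\<open>distrib\<close>).\<close>

lemma pdist_path_point:
  assumes "1 \<le> a" "a \<le> n" "1 \<le> v" "v \<le> n" "0 \<le> t" "t \<noteq> 0 \<longrightarrow> a < n \<and> t < d a (Suc a)"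
  shows "pdist n d i j (a, Suc a, t) v = path_dist i j (X a + t) v"
proof (cases "t = 0")
  case True
  then show ?thesis using gdist_eq[of a v] assms by (simp add: pdist_def)
next
  case False
  have split: "min (t + \<bar>X a - X z\<bar>) (d a (Suc a) - t + \<bar>X (Suc a) - X z\<bar>) = \<bar>X a + t - X z\<bar>"
    if "1 \<le> z" "z \<le> n" for z
    using that assms False X_Suc[of a] X_mono[of z a] X_mono[of "Suc a" z]
    by (cases "z \<le> a") auto
  have distrib: "min (t + min x (min (y + e + z) (w + e + u)))
      (s + min x' (min (y' + e + z) (w' + e + u)))
    = min (min (t + x) (s + x')) (min (min (t + y) (s + y') + e + z) (min (t + w) (s + w') + e + u))"
    for x y z w u s e x' y' w' :: real
    by (simp add: min_def)
  have "pdist n d i j (a, Suc a, t) v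
      = min (t + path_dist i j (X a) v) (d a (Suc a) - t + path_dist i j (X (Suc a)) v)"
    using assms False gdist_eq[of a v] gdist_eq[of "Suc a" v] by (simp add: pdist_def)
  then show ?thesis
    unfolding path_dist_def distrib
    using split[of v] split[of i] split[of j] assms(3,4) ij by (simp only:)
qed

text \<open>Leaving through one end and then crossing the whole new edge is no shorter than leaving
  through the other end at once; \<open>absorb\<close> removes these routes.\<close>

lemma pdist_edge_point:
  assumes "1 \<le> v" "v \<le> n" "0 < t" "t < d i j"
  shows "pdist n d i j (i, j, t) v = min (t + \<bar>X i - X v\<bar>) (d i j - t + \<bar>X j - X v\<bar>)"
proof -
  have absorb: "min (t + min P (min (e + Q) (E + e + P))) (e - t + min Q (min (E + e + Q) (e + P)))
      = min (t + P) (e - t + Q)"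
    if "0 < t" "t < e" "0 \<le> E" for t e E P Q :: real
    using that unfolding min_def by auto
  show ?thesis
    using assms gdist_eq[of i v] gdist_eq[of j v] ij
      absorb[of t "d i j" "\<bar>X i - X j\<bar>" "\<bar>X i - X v\<bar>" "\<bar>X j - X v\<bar>"]
    unfolding pdist_def path_dist_def by (simp add: abs_minus_commute)
qed

lemma pdist_flip:
  assumes "adjG n i j a b" "0 < t" "t < d a b"
  shows "pdist n d i j (b, a, d a b - t) v = pdist n d i j (a, b, t) v"
  using assms d_sym[of a b] unfolding pdist_def adjG_def by (auto simp: min.commute)

text \<open>Replaces the encoding of points by one real coordinate. An edge may be listed from
  either end, and \<open>pdist_flip\<close> turns it into the wanted direction.\<close>

lemma point_cases:
  assumes "is_point n d i j p"
  obtains (path) y where "0 \<le> y" "y \<le> X n"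
      "\<And>v. 1 \<le> v \<Longrightarrow> v \<le> n \<Longrightarrow> pdist n d i j p v = path_dist i j y v"
    | (edge) t where "i < j" "0 < t" "t < d i j"
      "\<And>v. 1 \<le> v \<Longrightarrow> v \<le> n \<Longrightarrow>
         pdist n d i j p v = min (t + \<bar>X i - X v\<bar>) (d i j - t + \<bar>X j - X v\<bar>)"
proof -
  obtain a b t where p: "p = (a, b, t)" by (cases p)
  consider (vertex) "t = 0" "1 \<le> a" "a \<le> n"
    | (adj) "adjG n i j a b" "0 < t" "t < d a b"
    using assms unfolding p is_point_def by auto
  then show ?thesis
  proof cases
    case vertex
    then have "pdist n d i j p v = path_dist i j (X a) v" if "1 \<le> v" "v \<le> n" for v
      using gdist_eq[of a v] that unfolding p pdist_def by auto
    then show ?thesis using path[of "X a"] vertex X_nonneg X_le_last by auto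
  next
    case adj
    have ab: "1 \<le> a" "a \<le> n" "1 \<le> b" "b \<le> n" using adj unfolding adjG_def by auto
    have dba: "d b a = d a b" using d_sym ab by auto
    have flip: "pdist n d i j p v = pdist n d i j (b, a, d a b - t) v" for v
      using pdist_flip adj unfolding p by simp
    consider "b = Suc a" | "a = Suc b" | "i < j" "a = i" "b = j" | "i < j" "a = j" "b = i"
      using adj unfolding adjG_def doubleton_eq_iff by auto
    then show ?thesis
    proof cases
      case 1
      then show ?thesis
        using path[of "X a + t"] pdist_path_point[of a _ t] adj ab X_Suc[of a] X_nonneg[of a]
          X_le_last[of "Suc a"] unfolding p by auto
    next
      case 2
      then show ?thesis
        using path[of "X b + (d a b - t)"] pdist_path_point[of b _ "d a b - t"] adj ab dba
          X_Suc[of b] X_nonneg[of b] X_le_last[of "Suc b"] unfolding flip by auto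
    next
      case 3
      then show ?thesis using edge[of t] pdist_edge_point adj unfolding p by auto
    next
      case 4
      then show ?thesis
        using edge[of "d a b - t"] pdist_edge_point[of _ "d a b - t"] adj dba
        unfolding flip by auto
    qed
  qed
qed

end

lemma pdist_le_ecc: "1 \<le> v \<Longrightarrow> v \<le> n \<Longrightarrow> pdist n d i j p v \<le> ecc n d i j p"
  unfolding ecc_def by (rule Max_ge) auto

lemma ecc_le: "(\<And>v. 1 \<le> v \<Longrightarrow> v \<le> n \<Longrightarrow> pdist n d i j p v \<le> r) \<Longrightarrow> ecc n d i j p \<le> r"
  unfolding ecc_def using n_pos by (subst Max_le_iff) auto

section \<open>Spanning trees\<close>

text \<open>The diameter of the tree obtained from \<open>G(i,j)\<close> by deleting the path edge
  between \<open>v\<^sub>m\<close> and \<open>v\<^sub>m\<^sub>+\<^sub>1\<close>, where \<open>i \<le> m < j\<close>.\<close>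
definition tree_diam :: "nat \<Rightarrow> nat \<Rightarrow> nat \<Rightarrow> real" where
  "tree_diam m i j = max (max (X m) (X n - X (Suc m)))
     (max (X i) (X m - X i) + d i j + max (X n - X j) (X j - X (Suc m)))"

lemma tree_diam_le_iff: "tree_diam m i j \<le> r \<longleftrightarrow> X m \<le> r \<and> X n - X (Suc m) \<le> r
    \<and> X i + d i j + (X n - X j) \<le> r \<and> X i + d i j + (X j - X (Suc m)) \<le> r
    \<and> X m - X i + d i j + (X n - X j) \<le> r \<and> X m - X i + d i j + (X j - X (Suc m)) \<le> r"
  unfolding tree_diam_def by (auto simp: max_def)

section \<open>Lower bound on the eccentricity of an arbitrary point\<close>

lemma tree_diam_le_path_point:
  assumes ij: "1 \<le> i" "i \<le> j" "j \<le> n" and y: "0 \<le> y" "y \<le> X n"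
    and cover: "\<And>v. 1 \<le> v \<Longrightarrow> v \<le> n \<Longrightarrow> path_dist i j y v \<le> r"
  shows "X n \<le> 2 * r \<or> (\<exists>m. i \<le> m \<and> m < j \<and> tree_diam m i j \<le> 2 * r)"
proof -
  have X_ij: "0 \<le> X i" "X i \<le> X j" "X j \<le> X n" using X_mono X_nonneg ij by auto
  have d_ij: "0 \<le> d i j" "d i j \<le> X j - X i" using d_nonneg d_le_X ij by auto
  have c1: "path_dist i j y 1 \<le> r" and cn: "path_dist i j y n \<le> r"
    and ci: "path_dist i j y i \<le> r" and cj: "path_dist i j y j \<le> r"
    using cover ij n_pos by auto
  consider (i_first) "i < j" "\<bar>y - X i\<bar> + d i j \<le> \<bar>y - X j\<bar>"
    | (j_first) "i < j" "\<bar>y - X j\<bar> + d i j \<le> \<bar>y - X i\<bar>"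
    | (direct) "i = j \<or> \<bar>y - X j\<bar> < \<bar>y - X i\<bar> + d i j \<and> \<bar>y - X i\<bar> < \<bar>y - X j\<bar> + d i j"
    using ij by linarith
  then show ?thesis
  proof cases
    \<comment> \<open>The new edge brings neither of its ends closer to the point, so v_1 and v_n
      are both reached along P and the two distances add up to |P|.\<close>
    case direct
    then have "\<bar>y - X i\<bar> \<le> \<bar>y - X j\<bar> + d i j" "\<bar>y - X j\<bar> \<le> \<bar>y - X i\<bar> + d i j"
      "i = j \<or> X i < y \<and> y < X j"
      using d_ij X_ij by auto
    then have "y \<le> r" "X n - y \<le> r"
      using c1 cn y X_ij d_ij unfolding path_dist_le_iff by auto
    then show ?thesis by linarith
  next
    case i_first
    then have lt: "X i < X j" using X_strict ij by auto
    \<comment> \<open>The detour through v_i and the new edge, then back from v_j, gets shorter as k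
      grows. Deleting the path edge in front of the least such k separates vertices within r along P
      from vertices within r by the detour; each term of \<open>tree_diam\<close> is at most a sum
      of two such lengths.\<close>
    define Q where "Q k \<longleftrightarrow> i < k \<and> \<bar>y - X i\<bar> + d i j + (X j - X k) \<le> r" for k
    define k where "k = (LEAST k. Q k)"
    have n_far: "\<bar>y - X i\<bar> + d i j + (X n - X j) \<le> r"
      using cn lt i_first X_ij d_ij unfolding path_dist_le_iff by linarith
    then have "Q j" using lt i_first X_ij unfolding Q_def by auto
    then have k: "Q k" "k \<le> j" unfolding k_def by (auto intro: LeastI Least_le)
    then obtain m where m: "k = Suc m" "i \<le> m" "m < j" unfolding Q_def by (cases k) auto
    have X_m: "X i \<le> X m" "X m \<le> X j" using X_mono m ij by auto
    \<comment> \<open>If m > i, minimality of k excludes the detour for v_m; if m = i, the detour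
      would only return to v_i.\<close>
    have "\<bar>y - X m\<bar> \<le> r"
    proof (cases "m = i")
      case True
      then show ?thesis using ci lt i_first X_ij d_ij unfolding path_dist_le_iff by auto
    next
      case False
      have "\<not> Q m" using not_less_Least[of m Q] m unfolding k_def by simp
      then have "\<not> \<bar>y - X i\<bar> + d i j + (X j - X m) \<le> r" using False m unfolding Q_def by simp
      moreover have "path_dist i j y m \<le> r" using cover[of m] m ij by simp
      ultimately show ?thesis using lt i_first X_m d_ij unfolding path_dist_le_iff by linarith
    qed
    moreover have "y \<le> r" using c1 y X_ij d_ij lt i_first unfolding path_dist_le_iff by auto
    ultimately have "tree_diam m i j \<le> 2 * r"
      using k(1) n_far d_ij unfolding tree_diam_le_iff Q_def m(1) by (auto simp: abs_le_iff)
    then show ?thesis using m by blast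
  next
    case j_first
    then have lt: "X i < X j" using X_strict ij by auto
    define Q where "Q k \<longleftrightarrow> \<bar>y - X j\<bar> + d i j + (X k - X i) \<le> r" for k
    \<comment> \<open>Here the detour gets longer as k grows, so the cut comes just before its first
      failure. The alternative k = j guarantees that a least k exists and that m < j.\<close>
    define k where "k = (LEAST k. i < k \<and> (k = j \<or> \<not> Q k))"
    have one_far: "\<bar>y - X j\<bar> + d i j + X i \<le> r"
      using c1 lt j_first X_ij d_ij y unfolding path_dist_le_iff by auto
    then have "Q i" using X_ij unfolding Q_def by auto
    have "i < k \<and> (k = j \<or> \<not> Q k)"
      unfolding k_def by (rule LeastI[of _ j]) (use j_first in auto)
    moreover have "k \<le> j" unfolding k_def by (rule Least_le) (use j_first in auto)
    ultimately obtain m where m: "k = Suc m" "i \<le> m" "m < j" and k: "k = j \<or> \<not> Q k"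
      by (cases k) auto
    have "Q m"
      using not_less_Least[of m "\<lambda>k. i < k \<and> (k = j \<or> \<not> Q k)"] m \<open>Q i\<close>
      unfolding k_def by (cases "m = i") auto
    have X_k: "X i \<le> X k" "X k \<le> X j" using X_mono m ij by auto
    have "\<bar>y - X k\<bar> \<le> r"
    proof (cases "k = j")
      case True
      then show ?thesis using cj lt j_first X_ij d_ij unfolding path_dist_le_iff by auto
    next
      case False
      then have "\<not> \<bar>y - X j\<bar> + d i j + (X k - X i) \<le> r" using k unfolding Q_def by simp
      moreover have "path_dist i j y k \<le> r" using cover[of k] m ij by simp
      ultimately show ?thesis using lt j_first X_k d_ij unfolding path_dist_le_iff by linarith
    qed
    moreover have "X n - y \<le> r" using cn y X_ij d_ij lt j_first unfolding path_dist_le_iff by auto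
    ultimately have "tree_diam m i j \<le> 2 * r"
      using \<open>Q m\<close> one_far d_ij unfolding tree_diam_le_iff Q_def m(1) by (auto simp: abs_le_iff)
    then show ?thesis using m by blast
  qed
qed

text \<open>An inner point of the new edge reaches each vertex through v_i or through v_j. The first
  vertex after v_i that is within \<open>r\<close> through v_j determines the path edge to
  delete.\<close>

lemma tree_diam_le_edge_point:
  assumes ij: "1 \<le> i" "i < j" "j \<le> n" and t: "0 < t" "t < d i j"
    and cover: "\<And>v. 1 \<le> v \<Longrightarrow> v \<le> n \<Longrightarrow>
      min (t + \<bar>X i - X v\<bar>) (d i j - t + \<bar>X j - X v\<bar>) \<le> r"
  shows "\<exists>m. i \<le> m \<and> m < j \<and> tree_diam m i j \<le> 2 * r"
proof -
  have X_ij: "0 \<le> X i" "X i \<le> X j" "X j \<le> X n" using X_mono X_nonneg ij by auto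
  have d_ij: "d i j \<le> X j - X i" using d_le_X ij by auto
  define Q where "Q k \<longleftrightarrow> i < k \<and> d i j - t + (X j - X k) \<le> r" for k
  define k where "k = (LEAST k. Q k)"
  have one: "t + X i \<le> r" and last: "d i j - t + (X n - X j) \<le> r"
    using cover[of 1] cover[of n] n_pos X_ij d_ij t by auto
  then have "Q j" using ij X_ij unfolding Q_def by auto
  then have k: "Q k" "k \<le> j" unfolding k_def by (auto intro: LeastI Least_le)
  then obtain m where m: "k = Suc m" "i \<le> m" "m < j" unfolding Q_def by (cases k) auto
  have X_m: "X i \<le> X m" "X m \<le> X j" using X_mono m ij by auto
  have "t + (X m - X i) \<le> r"
  proof (cases "m = i")
    case True
    then show ?thesis using one X_ij by auto
  next
    case False
    have "\<not> Q m" using not_less_Least[of m Q] m unfolding k_def by simp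
    then have "\<not> d i j - t + (X j - X m) \<le> r" using False m unfolding Q_def by simp
    then show ?thesis using cover[of m] m ij X_m by auto
  qed
  then have "tree_diam m i j \<le> 2 * r"
    using k(1) one last t unfolding tree_diam_le_iff Q_def m(1) by (auto simp: abs_le_iff)
  then show ?thesis using m by blast
qed

lemma ecc_lower_bound:
  assumes ij: "1 \<le> i" "i \<le> j" "j \<le> n" and p: "is_point n d i j p"
  shows "X n \<le> 2 * ecc n d i j p \<or>
    (\<exists>m. i \<le> m \<and> m < j \<and> tree_diam m i j \<le> 2 * ecc n d i j p)"
  using ij p
proof (cases rule: point_cases)
  case (path y)
  then show ?thesis using tree_diam_le_path_point[OF ij, of y] pdist_le_ecc by metis
next
  case (edge t)
  then show ?thesis using tree_diam_le_edge_point[of i j t] pdist_le_ecc ij by metis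
qed

text \<open>By the triangle inequality, moving an endpoint of the new edge towards the middle of its
  component does not increase \<open>tree_diam\<close>.\<close>
lemma left_candidate:
  assumes i: "1 \<le> i" "i \<le> m" "m < j" "j \<le> n" and p: "1 \<le> p" "p \<le> m" "2 * X p \<le> X m"
    and p': "p' = (if p < m then Suc p else p)" "p < m \<Longrightarrow> X m < 2 * X p'"
  shows "tree_diam m p j \<le> tree_diam m i j \<or> tree_diam m p' j \<le> tree_diam m i j"
proof (cases "i \<le> p")
  case True
  then show ?thesis
    using X_mono[of i p] i p d_triangle[of p j i] d_sym[of i p] d_le_X[of i p]
    unfolding tree_diam_def by auto
next
  case False
  then have "p < m" "p' = Suc p" "p' \<le> i" using i p' by auto
  then show ?thesis
    using X_mono[of p' i] i p p' d_triangle[of p' j i] d_le_X[of p' i]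
    unfolding tree_diam_def by auto
qed

text \<open>Mirror image of \<open>left_candidate\<close>: (X n + X (Suc m)) / 2 is the midpoint of
  v_(m+1), ..., v_n. As \<open>i\<close> is arbitrary, it applies after the left end has been
  moved.\<close>

lemma right_candidate:
  assumes i: "1 \<le> i" "i \<le> m" "m < j" "j \<le> n" and q: "m < q" "q \<le> n" "2 * X q \<le> X n + X (Suc m)"
    and q': "q' = (if q < n then Suc q else q)" "q < n \<Longrightarrow> X n + X (Suc m) < 2 * X q'"
  shows "tree_diam m i q \<le> tree_diam m i j \<or> tree_diam m i q' \<le> tree_diam m i j"
proof (cases "j \<le> q")
  case True
  then show ?thesis
    using X_mono[of j q] i q d_triangle[of i q j] d_le_X[of j q]
    unfolding tree_diam_def by auto
next
  case False
  then have "q < n" "q' = Suc q" "q' \<le> j" using i q' by auto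
  then show ?thesis
    using X_mono[of q' j] i q q' d_triangle[of i q' j] d_sym[of j q'] d_le_X[of q' j]
    unfolding tree_diam_def by auto
qed

section \<open>Centers\<close>

text \<open>\<open>y\<close> is the distance from \<open>v\<^sub>i\<close> on the new edge if \<open>new\<close>, and the distance from
  \<open>v\<^sub>1\<close> along the path otherwise.\<close>
definition covers :: "bool \<Rightarrow> nat \<Rightarrow> nat \<Rightarrow> real \<Rightarrow> real \<Rightarrow> bool" where
  "covers new i j y r \<longleftrightarrow> 1 \<le> i \<and> i \<le> j \<and> j \<le> n \<and>
     (if new then i < j \<and> 0 \<le> y \<and> y \<le> d i j \<and>
        (\<forall>v. 1 \<le> v \<longrightarrow> v \<le> n \<longrightarrow> min (y + \<bar>X i - X v\<bar>) (d i j - y + \<bar>X j - X v\<bar>) \<le> r)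
      else 0 \<le> y \<and> y \<le> X n \<and> (\<forall>v. 1 \<le> v \<longrightarrow> v \<le> n \<longrightarrow> path_dist i j y v \<le> r))"

text \<open>The midpoint of P, where the pair (1,1) stands for adding no edge. This is the initial
  solution of the search.\<close>

lemma covers_path: "covers False 1 1 (X n / 2) (X n / 2)"
  using n_pos X_nonneg X_le_last d_self[of 1] X_nonneg[of n]
  unfolding covers_def path_dist_def by (auto simp: min_le_iff_disj abs_le_iff field_simps)

text \<open>\<open>A\<close> and \<open>B\<close> are the eccentricities of v_i and v_j in the two
  paths. If they differ by at most d i j, the longest path crosses the new edge and its midpoint
  lies there, at distance r - A from v_i. Otherwise the midpoint lies in the component with the
  larger value, at distance r from the end of that component farthest from the new edge.\<close>

lemma covers_tree:
  fixes m i j :: nat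
  assumes ij: "1 \<le> i" "i \<le> m" "m < j" "j \<le> n"
  defines "A \<equiv> max (X i) (X m - X i)" and "B \<equiv> max (X n - X j) (X j - X (Suc m))"
    and "r \<equiv> tree_diam m i j / 2"
  shows "d i j + B < A \<Longrightarrow> X m - X i < X i \<Longrightarrow> covers False i j r r"
    and "d i j + B < A \<Longrightarrow> \<not> X m - X i < X i \<Longrightarrow> covers False i j (X m - r) r"
    and "d i j + A < B \<Longrightarrow> X j - X (Suc m) < X n - X j \<Longrightarrow> covers False i j (X n - r) r"
    and "d i j + A < B \<Longrightarrow> \<not> X j - X (Suc m) < X n - X j \<Longrightarrow> covers False i j (X (Suc m) + r) r"
    and "\<not> d i j + B < A \<Longrightarrow> \<not> d i j + A < B \<Longrightarrow> covers True i j (r - A) r"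
proof -
  have X_ij: "0 \<le> X i" "X i \<le> X m" "X m \<le> X (Suc m)" "X (Suc m) \<le> X j" "X j \<le> X n"
    using X_mono X_nonneg ij by auto
  have d_ij: "0 \<le> d i j" using d_nonneg ij by auto
  have range: "1 \<le> i" "i < j" "i \<le> j" "j \<le> n" using ij by auto
  have AB: "X i \<le> A" "X m - X i \<le> A" "X n - X j \<le> B" "X j - X (Suc m) \<le> B"
    unfolding A_def B_def by auto
  have sides: "(0 \<le> X v \<and> X v \<le> X m \<and> \<bar>X i - X v\<bar> \<le> A)
      \<or> (X (Suc m) \<le> X v \<and> X v \<le> X n \<and> \<bar>X j - X v\<bar> \<le> B)" if "1 \<le> v" "v \<le> n" for v
    using X_mono[of v m] X_mono[of "Suc m" v] X_nonneg[of v] X_le_last[of v] that ij AB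
    by (cases "v \<le> m") auto
  have r: "X m \<le> 2 * r" "X n - X (Suc m) \<le> 2 * r" "A + d i j + B \<le> 2 * r"
    unfolding r_def A_def B_def tree_diam_def by auto
  \<comment> \<open>X m is the sum of two numbers that are at most \<open>A\<close>, and X n - X
    (Suc m) of two that are at most \<open>B\<close>, so 2 * b bounds the diameters of both
    components.\<close>
  have r_le: "r \<le> b" if "A \<le> b" "B \<le> b" "A + d i j + B \<le> 2 * b" for b
  proof -
    have "tree_diam m i j \<le> 2 * b"
      using that AB d_ij unfolding tree_diam_le_iff by linarith
    then show ?thesis unfolding r_def by simp
  qed
  show "covers False i j r r" if less: "d i j + B < A" "X m - X i < X i"
  proof -
    have "A = X i" using less(2) unfolding A_def by simp
    then have "r \<le> X i" using r_le[of "X i"] less AB X_ij d_ij by auto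
    then have "path_dist i j r v \<le> r" if "1 \<le> v" "v \<le> n" for v
      using sides[OF that] r \<open>A = X i\<close> X_ij d_ij unfolding path_dist_le_iff
      by (elim disjE) auto
    then show ?thesis using range X_ij r \<open>r \<le> X i\<close> unfolding covers_def by auto
  qed
  show "covers False i j (X m - r) r" if less: "d i j + B < A" "\<not> X m - X i < X i"
  proof -
    have "A = X m - X i" using less(2) unfolding A_def by simp
    then have "r \<le> X m - X i" using r_le[of "X m - X i"] less AB X_ij d_ij by auto
    then have "path_dist i j (X m - r) v \<le> r" if "1 \<le> v" "v \<le> n" for v
      using sides[OF that] r \<open>A = X m - X i\<close> X_ij d_ij unfolding path_dist_le_iff
      by (elim disjE) auto
    then show ?thesis using range X_ij r \<open>r \<le> X m - X i\<close> unfolding covers_def by auto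
  qed
  show "covers False i j (X n - r) r" if less: "d i j + A < B" "X j - X (Suc m) < X n - X j"
  proof -
    have "B = X n - X j" using less(2) unfolding B_def by simp
    then have "r \<le> X n - X j" using r_le[of "X n - X j"] less AB X_ij d_ij by auto
    then have "path_dist i j (X n - r) v \<le> r" if "1 \<le> v" "v \<le> n" for v
      using sides[OF that] r \<open>B = X n - X j\<close> X_ij d_ij unfolding path_dist_le_iff
      by (elim disjE) auto
    then show ?thesis using range X_ij r \<open>r \<le> X n - X j\<close> unfolding covers_def by auto
  qed
  show "covers False i j (X (Suc m) + r) r"
    if less: "d i j + A < B" "\<not> X j - X (Suc m) < X n - X j"
  proof -
    have "B = X j - X (Suc m)" using less(2) unfolding B_def by simp
    then have "r \<le> X j - X (Suc m)" using r_le[of "X j - X (Suc m)"] less AB X_ij d_ij by auto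
    then have "path_dist i j (X (Suc m) + r) v \<le> r" if "1 \<le> v" "v \<le> n" for v
      using sides[OF that] r \<open>B = X j - X (Suc m)\<close> X_ij d_ij unfolding path_dist_le_iff
      by (elim disjE) auto
    then show ?thesis using range X_ij r \<open>r \<le> X j - X (Suc m)\<close> unfolding covers_def by auto
  qed
  show "covers True i j (r - A) r" if less: "\<not> d i j + B < A" "\<not> d i j + A < B"
  proof -
    have "r \<le> A + d i j" using r_le[of "A + d i j"] less d_ij by auto
    moreover have "min (r - A + \<bar>X i - X v\<bar>) (d i j - (r - A) + \<bar>X j - X v\<bar>) \<le> r"
      if "1 \<le> v" "v \<le> n" for v
      using sides[OF that] r by (elim disjE) auto
    ultimately show ?thesis using range r less unfolding covers_def by auto
  qed
qed

text \<open>Turns a coordinate into an encoded point. For a = n, both X n \<le> y and y \<le> X n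
  hold, so the offset is 0 and the triple denotes the vertex v_n.\<close>

lemma ecc_path_center:
  assumes "covers False i j y r" "1 \<le> a" "a \<le> n" "X a \<le> y" "a = n \<or> y < X (Suc a)"
  shows "is_point n d i j (a, Suc a, y - X a)" "ecc n d i j (a, Suc a, y - X a) \<le> r"
proof -
  have ij: "1 \<le> i" "i \<le> j" "j \<le> n" and y: "y \<le> X n"
    and cover: "\<And>v. 1 \<le> v \<Longrightarrow> v \<le> n \<Longrightarrow> path_dist i j y v \<le> r"
    using assms(1) unfolding covers_def by auto
  have t: "y - X a \<noteq> 0 \<longrightarrow> a < n \<and> y - X a < d a (Suc a)"
    using assms y X_Suc[of a] by (cases "a = n") auto
  show "is_point n d i j (a, Suc a, y - X a)"
    using t assms unfolding is_point_def adjG_def by auto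
  show "ecc n d i j (a, Suc a, y - X a) \<le> r"
    using pdist_path_point[OF ij, of a _ "y - X a"] t assms cover by (intro ecc_le) auto
qed

text \<open>The encoding admits only inner points of an edge, so a center at either end of the new
  edge has to be given as a vertex.\<close>

lemma ecc_edge_center:
  assumes "covers True i j t r"
  shows "t = 0 \<Longrightarrow> is_point n d i j (i, j, 0) \<and> ecc n d i j (i, j, 0) \<le> r"
    and "t = d i j \<Longrightarrow> is_point n d i j (j, j, 0) \<and> ecc n d i j (j, j, 0) \<le> r"
    and "t \<noteq> 0 \<Longrightarrow> t \<noteq> d i j \<Longrightarrow> is_point n d i j (i, j, t) \<and> ecc n d i j (i, j, t) \<le> r"
proof -
  have ij: "1 \<le> i" "i \<le> j" "j \<le> n" "i < j" and t: "0 \<le> t" "t \<le> d i j"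
    and cover: "\<And>v. 1 \<le> v \<Longrightarrow> v \<le> n \<Longrightarrow>
      min (t + \<bar>X i - X v\<bar>) (d i j - t + \<bar>X j - X v\<bar>) \<le> r"
    using assms unfolding covers_def by auto
  have d_ij: "0 \<le> d i j" using d_nonneg ij by auto
  show "is_point n d i j (i, j, 0) \<and> ecc n d i j (i, j, 0) \<le> r" if "t = 0"
  proof (intro conjI ecc_le)
    fix v assume v: "1 \<le> v" "v \<le> n"
    show "pdist n d i j (i, j, 0) v \<le> r"
      using cover[OF v] that v ij gdist_eq[OF ij(1-3), of i v]
      by (auto simp: pdist_def path_dist_le_iff min_le_iff_disj)
  qed (use ij in \<open>auto simp: is_point_def\<close>)
  show "is_point n d i j (j, j, 0) \<and> ecc n d i j (j, j, 0) \<le> r" if "t = d i j"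
  proof (intro conjI ecc_le)
    fix v assume v: "1 \<le> v" "v \<le> n"
    show "pdist n d i j (j, j, 0) v \<le> r"
      using cover[OF v] that v ij gdist_eq[OF ij(1-3), of j v]
      by (auto simp: pdist_def path_dist_le_iff min_le_iff_disj)
  qed (use ij in \<open>auto simp: is_point_def\<close>)
  show "is_point n d i j (i, j, t) \<and> ecc n d i j (i, j, t) \<le> r" if "t \<noteq> 0" "t \<noteq> d i j"
  proof (intro conjI ecc_le)
    fix v assume v: "1 \<le> v" "v \<le> n"
    show "pdist n d i j (i, j, t) v \<le> r"
      using cover[OF v] that v ij t pdist_edge_point[OF ij(1-3), of v t] by auto
  qed (use ij t that in \<open>auto simp: is_point_def adjG_def\<close>)
qed

lemma optimal_center:
  assumes ij: "1 \<le> i" "i \<le> j" "j \<le> n" and p: "is_point n d i j p" "ecc n d i j p \<le> r"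
    and le_path: "2 * r \<le> X n"
    and le_tree: "\<And>m i' j'. 1 \<le> i' \<Longrightarrow> i' \<le> m \<Longrightarrow> m < j' \<Longrightarrow> j' \<le> n \<Longrightarrow> 2 * r \<le> tree_diam m i' j'"
  shows "radius n d i j = r" "is_center n d i j p"
    "\<And>i' j'. 1 \<le> i' \<Longrightarrow> i' \<le> j' \<Longrightarrow> j' \<le> n \<Longrightarrow> r \<le> radius n d i' j'"
proof -
  have lower: "r \<le> ecc n d i' j' p'"
    if "1 \<le> i'" "i' \<le> j'" "j' \<le> n" "is_point n d i' j' p'" for i' j' p'
    using ecc_lower_bound[OF that] le_path le_tree[of i' _ j'] that by fastforce
  show "r \<le> radius n d i' j'" if "1 \<le> i'" "i' \<le> j'" "j' \<le> n" for i' j'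
    unfolding radius_def
  proof (rule cInf_greatest)
    have "is_point n d i' j' (1, 1, 0)" using n_pos by (simp add: is_point_def)
    then show "ecc n d i' j' ` {p. is_point n d i' j' p} \<noteq> {}" by blast
  qed (use lower that in auto)
  have ecc: "ecc n d i j p = r" using lower[OF ij p(1)] p(2) by simp
  show "radius n d i j = r"
    unfolding radius_def by (rule cInf_eq_minimum) (use ecc p lower ij in auto)
  then show "is_center n d i j p" unfolding is_center_def using ecc p by simp
qed

end

section \<open>Timed execution of programs\<close>

text \<open>The loop bodies of the program contain no loops. Their effect is thus a function
  \<open>run\<close> that the simplifier evaluates, and their cost is bounded by a number
  \<open>max_steps\<close> that depends on the code alone.\<close>

fun loop_free :: "com \<Rightarrow> bool" where
  "loop_free (Seq c1 c2) \<longleftrightarrow> loop_free c1 \<and> loop_free c2"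
| "loop_free (If b c1 c2) \<longleftrightarrow> loop_free c1 \<and> loop_free c2"
| "loop_free (While b c) \<longleftrightarrow> False"
| "loop_free _ \<longleftrightarrow> True"

fun run :: "(int \<Rightarrow> int \<Rightarrow> real) \<Rightarrow> com \<Rightarrow> state \<Rightarrow> state" where
  "run D SKIP s = s"
| "run D (IStore a e) s = ((fst s)(nat (aval a s) := aval e s), snd s)"
| "run D (RStore a e) s = (fst s, (snd s)(nat (aval a s) := rval D e s))"
| "run D (Seq c1 c2) s = run D c2 (run D c1 s)"
| "run D (If b c1 c2) s = (if bval D b s then run D c1 s else run D c2 s)"
| "run D (While b c) s = s"

fun max_steps :: "com \<Rightarrow> nat" where
  "max_steps (Seq c1 c2) = max_steps c1 + max_steps c2"
| "max_steps (If b c1 c2) = Suc (max (max_steps c1) (max_steps c2))"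
| "max_steps _ = 1"

lemma exec_run: "loop_free c \<Longrightarrow> \<exists>k \<le> max_steps c. exec D c s k (run D c s)"
proof (induction c arbitrary: s)
  case (Seq c1 c2)
  then obtain k1 k2 where "exec D c1 s k1 (run D c1 s)" "k1 \<le> max_steps c1"
    "exec D c2 (run D c1 s) k2 (run D c2 (run D c1 s))" "k2 \<le> max_steps c2"
    by (metis loop_free.simps(1))
  then show ?case using exec.Seq by (intro exI[of _ "k1 + k2"]) auto
next
  case (If b c1 c2)
  obtain k1 k2 where k: "exec D c1 s k1 (run D c1 s)" "k1 \<le> max_steps c1"
    "exec D c2 s k2 (run D c2 s)" "k2 \<le> max_steps c2"
    using If by (metis loop_free.simps(2))
  show ?case
  proof (cases "bval D b s")
    case True
    then show ?thesis using exec.IfT[OF True k(1)] k by (intro exI[of _ "Suc k1"]) auto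
  next
    case False
    then show ?thesis using exec.IfF[OF False k(3)] k by (intro exI[of _ "Suc k2"]) auto
  qed
qed (use exec.Skip exec.IStore exec.RStore in \<open>force intro!: exI[of _ "1::nat"]\<close>)+

text \<open>Total correctness with a linear time bound. The factors \<open>C\<close> add up under
  sequencing, and constant costs fit in because n \<ge> 1.\<close>

definition triple :: "(int \<Rightarrow> int \<Rightarrow> real) \<Rightarrow> nat \<Rightarrow> (state \<Rightarrow> bool) \<Rightarrow> com \<Rightarrow> nat \<Rightarrow> (state \<Rightarrow> bool) \<Rightarrow> bool"
  where "triple D n P c C Q \<longleftrightarrow>
    (\<forall>s. P s \<longrightarrow> (\<exists>k t. exec D c s k t \<and> k \<le> C * n \<and> Q t))"

lemma triple_Seq:
  assumes "triple D n P c1 C1 Q" "triple D n Q c2 C2 R"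
  shows "triple D n P (Seq c1 c2) (C1 + C2) R"
  unfolding triple_def
proof (intro allI impI)
  fix s assume "P s"
  then obtain k1 t1 where 1: "exec D c1 s k1 t1" "k1 \<le> C1 * n" "Q t1"
    using assms(1) unfolding triple_def by blast
  then obtain k2 t2 where 2: "exec D c2 t1 k2 t2" "k2 \<le> C2 * n" "R t2"
    using assms(2) unfolding triple_def by blast
  have "k1 + k2 \<le> (C1 + C2) * n" using 1 2 by (simp add: distrib_right)
  then show "\<exists>k t. exec D (Seq c1 c2) s k t \<and> k \<le> (C1 + C2) * n \<and> R t"
    using exec.Seq[OF 1(1) 2(1)] 2(3) by blast
qed

lemma triple_loop_free:
  assumes "loop_free c" "1 \<le> n" "\<And>s. P s \<Longrightarrow> Q (run D c s)"
  shows "triple D n P c (max_steps c) Q"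
  unfolding triple_def
proof (intro allI impI)
  fix s assume "P s"
  obtain k where k: "exec D c s k (run D c s)" "k \<le> max_steps c"
    using exec_run[OF assms(1)] by blast
  have "max_steps c * 1 \<le> max_steps c * n" using assms(2) by (intro mult_le_mono2)
  then have "k \<le> max_steps c * n" using k(2) by linarith
  then show "\<exists>k t. exec D c s k t \<and> k \<le> max_steps c * n \<and> Q t"
    using assms(3)[OF \<open>P s\<close>] k(1) by blast
qed

text \<open>Each unit of the measure pays for one body and one successful test; the final 1 is the
  failing test.\<close>

lemma exec_While:
  assumes "loop_free c"
    and step: "\<And>s. I s \<Longrightarrow> bval D b s \<Longrightarrow> I (run D c s) \<and> \<mu> (run D c s) < (\<mu> s :: nat)"
  shows "I s \<Longrightarrow> \<exists>k t. exec D (While b c) s k t \<and> k \<le> Suc (max_steps c) * \<mu> s + 1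
    \<and> I t \<and> \<not> bval D b t"
proof (induction "\<mu> s" arbitrary: s rule: less_induct)
  case less
  show ?case
  proof (cases "bval D b s")
    case False
    then show ?thesis using exec.WhileF less.prems by (intro exI[of _ 1] exI[of _ s]) auto
  next
    case True
    let ?s = "run D c s"
    have s: "I ?s" "\<mu> ?s < \<mu> s" using step less.prems True by auto
    obtain k t where t: "exec D (While b c) ?s k t" "k \<le> Suc (max_steps c) * \<mu> ?s + 1"
      "I t" "\<not> bval D b t"
      using less.hyps[OF s(2,1)] by blast
    obtain k' where k': "exec D c s k' ?s" "k' \<le> max_steps c"
      using exec_run[OF assms(1)] by blast
    have "Suc (max_steps c) * Suc (\<mu> ?s) \<le> Suc (max_steps c) * \<mu> s"
      using s(2) by (intro mult_le_mono2) simp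
    then have "Suc (k' + k) \<le> Suc (max_steps c) * \<mu> s + 1" using t(2) k'(2) by simp
    then show ?thesis using exec.WhileT[OF True k'(1) t(1)] t(3,4) by blast
  qed
qed

lemma triple_While:
  assumes "loop_free c" "1 \<le> n"
    and "\<And>s. I s \<Longrightarrow> bval D b s \<Longrightarrow> I (run D c s) \<and> \<mu> (run D c s) < (\<mu> s :: nat)"
    and "\<And>s. I s \<Longrightarrow> \<mu> s \<le> M * n"
  shows "triple D n I (While b c) (Suc (max_steps c) * M + 1) (\<lambda>t. I t \<and> \<not> bval D b t)"
  unfolding triple_def
proof (intro allI impI)
  fix s assume "I s"
  then obtain k t where t: "exec D (While b c) s k t" "k \<le> Suc (max_steps c) * \<mu> s + 1"
      "I t" "\<not> bval D b t"
    using exec_While[of c I D b \<mu> s] assms(1,3) by blast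
  have "Suc (max_steps c) * \<mu> s \<le> Suc (max_steps c) * (M * n)"
    using assms(4)[OF \<open>I s\<close>] by (rule mult_le_mono2)
  then have "k \<le> (Suc (max_steps c) * M + 1) * n"
    using t(2) assms(2) unfolding distrib_right mult.assoc by linarith
  then show "\<exists>k t. exec D (While b c) s k t \<and> k \<le> (Suc (max_steps c) * M + 1) * n
      \<and> I t \<and> \<not> bval D b t"
    using t by blast
qed

section \<open>The algorithm\<close>

text \<open>The numbering separates roles: integer addresses below 6 and real addresses below 7
  describe the position of the search, the next ones the best solution so far, and the real ones
  from 9 on are scratch. Trying an edge therefore preserves all low addresses.\<close>

abbreviation (input) "n_reg \<equiv> (0::nat)"
abbreviation (input) "p_reg \<equiv> (1::nat)"
abbreviation (input) "q_reg \<equiv> (2::nat)"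
abbreviation (input) "m_reg \<equiv> (3::nat)"
abbreviation (input) "p'_reg \<equiv> (4::nat)"
abbreviation (input) "q'_reg \<equiv> (5::nat)"
abbreviation (input) "i_reg \<equiv> (6::nat)"
abbreviation (input) "j_reg \<equiv> (7::nat)"
abbreviation (input) "new_reg \<equiv> (8::nat)"

text \<open>Registers of the real memory; \<open>Xm'_reg\<close> holds \<open>X (Suc m)\<close>, which is meaningful only for
  \<open>m < n\<close>.\<close>
abbreviation (input) "L_reg \<equiv> (0::nat)"
abbreviation (input) "Xp_reg \<equiv> (1::nat)"
abbreviation (input) "Xq_reg \<equiv> (2::nat)"
abbreviation (input) "Xm_reg \<equiv> (3::nat)"
abbreviation (input) "Xm'_reg \<equiv> (4::nat)"
abbreviation (input) "Xp'_reg \<equiv> (5::nat)"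
abbreviation (input) "Xq'_reg \<equiv> (6::nat)"
abbreviation (input) "best_reg \<equiv> (7::nat)"
abbreviation (input) "y_reg \<equiv> (8::nat)"
abbreviation (input) "A_reg \<equiv> (9::nat)"
abbreviation (input) "B_reg \<equiv> (10::nat)"
abbreviation (input) "D_reg \<equiv> (11::nat)"
abbreviation (input) "e_reg \<equiv> (12::nat)"

abbreviation ivar :: "nat \<Rightarrow> aexp" where "ivar k \<equiv> Mem (N (int k))"
abbreviation rvar :: "nat \<Rightarrow> rexp" where "rvar k \<equiv> RMem (N (int k))"
abbreviation isucc :: "nat \<Rightarrow> aexp" where "isucc k \<equiv> Plus (ivar k) (N 1)"
abbreviation iset :: "nat \<Rightarrow> aexp \<Rightarrow> com" where "iset k e \<equiv> IStore (N (int k)) e"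
abbreviation rset :: "nat \<Rightarrow> rexp \<Rightarrow> com" where "rset k e \<equiv> RStore (N (int k)) e"
abbreviation rhalf :: "rexp \<Rightarrow> rexp" where "rhalf e \<equiv> RDiv e (OfInt (N 2))"
abbreviation edge_after :: "nat \<Rightarrow> rexp" where "edge_after k \<equiv> Dist (ivar k) (isucc k)"

fun block :: "com list \<Rightarrow> com" where
  "block [] = SKIP"
| "block (c # cs) = Seq c (block cs)"

definition set_max :: "nat \<Rightarrow> rexp \<Rightarrow> rexp \<Rightarrow> com" where
  "set_max k e1 e2 = If (RLess e1 e2) (rset k e2) (rset k e1)"

definition measure_tree :: "nat \<Rightarrow> nat \<Rightarrow> nat \<Rightarrow> nat \<Rightarrow> com" where
  "measure_tree a Xa b Xb = block [
     rset e_reg (Dist (ivar a) (ivar b)),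
     set_max A_reg (rvar Xa) (RMinus (rvar Xm_reg) (rvar Xa)),
     set_max B_reg (RMinus (rvar L_reg) (rvar Xb)) (RMinus (rvar Xb) (rvar Xm'_reg)),
     set_max D_reg (rvar Xm_reg) (RMinus (rvar L_reg) (rvar Xm'_reg)),
     set_max D_reg (rvar D_reg) (RPlus (RPlus (rvar A_reg) (rvar e_reg)) (rvar B_reg))]"

text \<open>The branches are the five cases of \<open>covers_tree\<close>, with 2r in
  \<open>D_reg\<close>.\<close>

definition locate_center :: "nat \<Rightarrow> nat \<Rightarrow> com" where
  "locate_center Xa Xb =
     If (RLess (RPlus (rvar e_reg) (rvar B_reg)) (rvar A_reg))
       (Seq (iset new_reg (N 0))
         (If (RLess (RMinus (rvar Xm_reg) (rvar Xa)) (rvar Xa))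
           (rset y_reg (rhalf (rvar D_reg)))
           (rset y_reg (RMinus (rvar Xm_reg) (rhalf (rvar D_reg))))))
       (If (RLess (RPlus (rvar e_reg) (rvar A_reg)) (rvar B_reg))
         (Seq (iset new_reg (N 0))
           (If (RLess (RMinus (rvar Xb) (rvar Xm'_reg)) (RMinus (rvar L_reg) (rvar Xb)))
             (rset y_reg (RMinus (rvar L_reg) (rhalf (rvar D_reg))))
             (rset y_reg (RPlus (rvar Xm'_reg) (rhalf (rvar D_reg))))))
         (Seq (iset new_reg (N 1))
           (rset y_reg (RMinus (rhalf (rvar D_reg)) (rvar A_reg)))))"

definition try_edge :: "nat \<Rightarrow> nat \<Rightarrow> nat \<Rightarrow> nat \<Rightarrow> com" where
  "try_edge a Xa b Xb = Seq (measure_tree a Xa b Xb)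
     (If (RLess (rvar D_reg) (rvar best_reg))
       (block [rset best_reg (rvar D_reg), iset i_reg (ivar a), iset j_reg (ivar b),
         locate_center Xa Xb])
       SKIP)"

text \<open>At the end of a component the successor is replaced by the vertex itself, so the second
  candidate is always a valid vertex.\<close>

definition look_ahead :: com where
  "look_ahead = Seq
     (If (ILess (ivar p_reg) (ivar m_reg))
       (Seq (iset p'_reg (isucc p_reg))
         (rset Xp'_reg (RPlus (rvar Xp_reg) (edge_after p_reg))))
       (Seq (iset p'_reg (ivar p_reg)) (rset Xp'_reg (rvar Xp_reg))))
     (If (ILess (ivar q_reg) (ivar n_reg))
       (Seq (iset q'_reg (isucc q_reg))
         (rset Xq'_reg (RPlus (rvar Xq_reg) (edge_after q_reg))))
       (Seq (iset q'_reg (ivar q_reg)) (rset Xq'_reg (rvar Xq_reg))))"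

definition try_edges :: com where
  "try_edges = block [try_edge p_reg Xp_reg q_reg Xq_reg, try_edge p'_reg Xp'_reg q_reg Xq_reg,
     try_edge p_reg Xp_reg q'_reg Xq'_reg, try_edge p'_reg Xp'_reg q'_reg Xq'_reg]"

text \<open>The last store reads the already advanced m. If that is n, the oracle is asked out of
  range and contributes its default value 0.\<close>

definition next_m :: com where
  "next_m = block [iset m_reg (isucc m_reg), rset Xm_reg (rvar Xm'_reg),
     rset Xm'_reg (RPlus (rvar Xm'_reg) (edge_after m_reg))]"

text \<open>Each iteration advances just one of the pointers, so that \<open>3n - p - q - m\<close> bounds the number
  of iterations without an inner loop. Here \<open>v\<^sub>p\<close> is the last vertex not beyond the midpoint of
  \<open>v\<^sub>1, \<dots>, v\<^sub>m\<close>, and \<open>v\<^sub>q\<close> that for \<open>v\<^sub>m\<^sub>+\<^sub>1, \<dots>, v\<^sub>n\<close>, once both have stopped.\<close>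
definition search_step :: com where
  "search_step = Seq look_ahead
     (If (BAnd (ILess (ivar p_reg) (ivar m_reg))
           (BNot (RLess (rvar Xm_reg) (RPlus (rvar Xp'_reg) (rvar Xp'_reg)))))
       (Seq (iset p_reg (ivar p'_reg)) (rset Xp_reg (rvar Xp'_reg)))
       (If (BAnd (ILess (ivar q_reg) (ivar n_reg))
             (BNot (RLess (RPlus (rvar L_reg) (rvar Xm'_reg)) (RPlus (rvar Xq'_reg) (rvar Xq'_reg)))))
         (Seq (iset q_reg (ivar q'_reg)) (rset Xq_reg (rvar Xq'_reg)))
         (Seq try_edges next_m)))"

abbreviation "more_m \<equiv> ILess (ivar m_reg) (ivar n_reg)"

definition length_step :: com where
  "length_step = Seq (rset L_reg (RPlus (rvar L_reg) (edge_after m_reg)))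
     (iset m_reg (isucc m_reg))"

text \<open>The registers for X p, X q and X m are not assigned here: they still hold 0, which is X
  1.\<close>

definition start_search :: com where
  "start_search = block [iset p_reg (N 1), iset q_reg (N 1), iset m_reg (N 1),
     rset Xm'_reg (edge_after m_reg), rset best_reg (rvar L_reg), iset i_reg (N 1),
     iset j_reg (N 1), iset new_reg (N 0), rset y_reg (rhalf (rvar L_reg))]"

text \<open>From here on \<open>p_reg\<close>, \<open>q_reg\<close> and \<open>Xp_reg\<close> are reused for the three components of the center;
  if it lies on the path, \<open>Xp_reg\<close> is \<open>X p\<close> until \<open>write_output\<close> turns it into an offset.\<close>
definition start_walk :: com where
  "start_walk = If (IEq (ivar new_reg) (N 1))
     (If (REq (rvar y_reg) (OfInt (N 0)))
       (block [iset p_reg (ivar i_reg), iset q_reg (ivar j_reg), rset Xp_reg (OfInt (N 0))])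
       (If (REq (rvar y_reg) (Dist (ivar i_reg) (ivar j_reg)))
         (block [iset p_reg (ivar j_reg), iset q_reg (ivar j_reg), rset Xp_reg (OfInt (N 0))])
         (block [iset p_reg (ivar i_reg), iset q_reg (ivar j_reg), rset Xp_reg (rvar y_reg)])))
     (block [iset p_reg (N 1), rset Xp_reg (OfInt (N 0))])"

abbreviation "more_walk \<equiv> BAnd (BNot (IEq (ivar new_reg) (N 1)))
  (BAnd (ILess (ivar p_reg) (ivar n_reg))
    (BNot (RLess (rvar y_reg) (RPlus (rvar Xp_reg) (edge_after p_reg)))))"

definition walk_step :: com where
  "walk_step = Seq (rset Xp_reg (RPlus (rvar Xp_reg) (edge_after p_reg)))
     (iset p_reg (isucc p_reg))"

text \<open>\<open>p_reg\<close> and \<open>q_reg\<close> are the addresses 1 and 2, which are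
  output cells too; storing to 3, 2, 1 in this order copies each before it is overwritten.\<close>

definition write_output :: com where
  "write_output = Seq
     (If (IEq (ivar new_reg) (N 1)) SKIP
       (Seq (iset q_reg (isucc p_reg)) (rset Xp_reg (RMinus (rvar y_reg) (rvar Xp_reg)))))
     (block [iset 0 (ivar i_reg), iset 3 (ivar q_reg), iset 2 (ivar p_reg), iset 1 (ivar j_reg),
       rset 0 (rhalf (rvar best_reg))])"

definition program :: com where
  "program = Seq (iset m_reg (N 1)) (Seq (While more_m length_step)
     (Seq start_search (Seq (While more_m search_step)
     (Seq start_walk (Seq (While more_walk walk_step) write_output)))))"

definition program_cost :: nat where
  "program_cost = max_steps (iset m_reg (N 1)) + ((Suc (max_steps length_step) * 1 + 1)
     + (max_steps start_search + ((Suc (max_steps search_step) * 3 + 1)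
     + (max_steps start_walk + ((Suc (max_steps walk_step) * 1 + 1) + max_steps write_output)))))"

lemmas com_defs = set_max_def measure_tree_def locate_center_def try_edge_def look_ahead_def
  try_edges_def next_m_def search_step_def length_step_def start_search_def start_walk_def
  walk_step_def write_output_def

lemma loop_free_steps:
  "loop_free length_step" "loop_free start_search" "loop_free search_step"
  "loop_free start_walk" "loop_free walk_step" "loop_free write_output"
  by (simp_all add: com_defs)

lemma run_set_max [simp]:
  "run D (set_max k e1 e2) s = (fst s, (snd s)(k := max (rval D e1 s) (rval D e2 s)))"
  by (simp add: set_max_def max_def)

section \<open>Invariants and correctness of the program\<close>

context metric_path
begin

abbreviation "query \<equiv> dist_oracle n d"

lemma query_eq [simp]:
  "1 \<le> a \<Longrightarrow> a \<le> n \<Longrightarrow> 1 \<le> b \<Longrightarrow> b \<le> n \<Longrightarrow> query (int a) (int b) = d a b"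
  unfolding dist_oracle_def by simp

lemma query_Suc [simp]:
  "1 \<le> a \<Longrightarrow> a < n \<Longrightarrow> query (int a) (int a + 1) = d a (Suc a)"
  "1 \<le> a \<Longrightarrow> a < n \<Longrightarrow> query (int a) (1 + int a) = d a (Suc a)"
  unfolding dist_oracle_def by (auto simp: nat_add_distrib)

text \<open>Real address 7 holds twice the best radius. The invariant carries a point that attains
  the bound, together with optimality against |P| and the trees in \<open>T\<close>.\<close>

definition best_among :: "(nat \<times> nat \<times> nat) set \<Rightarrow> state \<Rightarrow> bool" where
  "best_among T s \<longleftrightarrow> (\<exists>i j. fst s 6 = int i \<and> fst s 7 = int j
     \<and> covers (fst s 8 = 1) i j (snd s 8) (snd s 7 / 2) \<and> snd s 7 \<le> X n
     \<and> (\<forall>(m', i', j') \<in> T. snd s 7 \<le> tree_diam m' i' j'))"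

text \<open>q = m is allowed, because the pointer may still lag one vertex behind the right
  component right after m has advanced.\<close>

definition position :: "nat \<Rightarrow> nat \<Rightarrow> nat \<Rightarrow> state \<Rightarrow> bool" where
  "position p q m s \<longleftrightarrow> fst s 0 = int n \<and> fst s 1 = int p \<and> fst s 2 = int q \<and> fst s 3 = int m
     \<and> snd s 0 = X n \<and> snd s 1 = X p \<and> snd s 2 = X q \<and> snd s 3 = X m
     \<and> (m < n \<longrightarrow> snd s 4 = X (Suc m))
     \<and> 1 \<le> p \<and> p \<le> m \<and> m \<le> q \<and> q \<le> n \<and> 2 * X p \<le> X m
     \<and> (m < n \<longrightarrow> 2 * X q \<le> X n + X (Suc m))"

lemma run_locate_center:
  fixes m i j :: nat
  defines "A \<equiv> max (X i) (X m - X i)" and "B \<equiv> max (X n - X j) (X j - X (Suc m))"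
  assumes g: "g 9 = A" "g 10 = B" "g 11 = tree_diam m i j" "g 12 = d i j" "g 0 = X n"
      "g 3 = X m" "g 4 = X (Suc m)" "g Xa = X i" "g Xb = X j"
    and ij: "1 \<le> i" "i \<le> m" "m < j" "j \<le> n"
  shows "\<exists>new y. run query (locate_center Xa Xb) (f, g) = (f(8 := new), g(8 := y))
    \<and> covers (new = 1) i j y (tree_diam m i j / 2)"
proof -
  note tree = covers_tree[OF ij, folded A_def B_def]
  let ?r = "tree_diam m i j / 2"
  consider (1) "d i j + B < A" "X m - X i < X i" | (2) "d i j + B < A" "\<not> X m - X i < X i"
    | (3) "\<not> d i j + B < A" "d i j + A < B" "X j - X (Suc m) < X n - X j"
    | (4) "\<not> d i j + B < A" "d i j + A < B" "\<not> X j - X (Suc m) < X n - X j"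
    | (5) "\<not> d i j + B < A" "\<not> d i j + A < B" by blast
  then show ?thesis
  proof cases
    case 1
    then show ?thesis
      using tree(1) g by (intro exI[of _ 0] exI[of _ ?r]) (simp add: locate_center_def)
  next
    case 2
    then show ?thesis
      using tree(2) g by (intro exI[of _ 0] exI[of _ "X m - ?r"]) (simp add: locate_center_def)
  next
    case 3
    then show ?thesis
      using tree(3) g by (intro exI[of _ 0] exI[of _ "X n - ?r"]) (simp add: locate_center_def)
  next
    case 4
    then show ?thesis
      using tree(4) g
      by (intro exI[of _ 0] exI[of _ "X (Suc m) + ?r"]) (simp add: locate_center_def)
  next
    case 5
    then show ?thesis
      using tree(5) g by (intro exI[of _ 1] exI[of _ "?r - A"]) (simp add: locate_center_def)
  qed
qed

lemma run_try_edge: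
  fixes a b Xa Xb :: nat
  assumes addr: "a < 6" "b < 6" "Xa < 7" "Xb < 7"
    and s: "fst s a = int i" "fst s b = int j" "snd s Xa = X i"
      "snd s Xb = X j" "snd s 0 = X n" "snd s 3 = X m" "snd s 4 = X (Suc m)"
    and ij: "1 \<le> i" "i \<le> m" "m < j" "j \<le> n"
    and best: "best_among T s"
  defines "s' \<equiv> run query (try_edge a Xa b Xb) s"
  shows "best_among (insert (m, i, j) T) s'" "\<And>k. k < 6 \<Longrightarrow> fst s' k = fst s k"
    "\<And>k. k < 7 \<Longrightarrow> snd s' k = snd s k"
proof -
  define A where "A = max (X i) (X m - X i)"
  define B where "B = max (X n - X j) (X j - X (Suc m))"
  define g where "g = snd (run query (measure_tree a Xa b Xb) s)"
  have neq: "Xa \<noteq> 7" "Xa \<noteq> 8" "Xa \<noteq> 9" "Xa \<noteq> 10" "Xa \<noteq> 11" "Xa \<noteq> 12"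
    "Xb \<noteq> 7" "Xb \<noteq> 8" "Xb \<noteq> 9" "Xb \<noteq> 10" "Xb \<noteq> 11" "Xb \<noteq> 12"
    "a \<noteq> 6" "a \<noteq> 7" "a \<noteq> 8" "b \<noteq> 6" "b \<noteq> 7" "b \<noteq> 8"
    using addr by auto
  have query: "query (int i) (int j) = d i j" using query_eq ij by simp
  have measure: "run query (measure_tree a Xa b Xb) s = (fst s, g)"
    unfolding g_def using neq by (simp add: measure_tree_def)
  have g: "g 9 = A" "g 10 = B" "g 11 = tree_diam m i j" "g 12 = d i j"
    "g 0 = X n" "g 3 = X m" "g 4 = X (Suc m)" "g Xa = X i" "g Xb = X j"
    and g_old: "\<And>k. k < 9 \<Longrightarrow> g k = snd s k"
    using s neq query unfolding g_def A_def B_def tree_diam_def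
    by (simp_all add: measure_tree_def)
  obtain i0 j0 where best': "fst s 6 = int i0" "fst s 7 = int j0"
    "covers (fst s 8 = 1) i0 j0 (snd s 8) (snd s 7 / 2)" "snd s 7 \<le> X n"
    "\<forall>(m', i', j') \<in> T. snd s 7 \<le> tree_diam m' i' j'"
    using best unfolding best_among_def by blast
  have "best_among (insert (m, i, j) T) s' \<and> (\<forall>k<6. fst s' k = fst s k) \<and> (\<forall>k<7. snd s' k = snd s k)"
  proof (cases "tree_diam m i j < snd s 7")
    case False
    then have "s' = (fst s, g)" unfolding s'_def try_edge_def using measure g g_old[of 7] by simp
    then show ?thesis
      using False best' g_old unfolding best_among_def by auto
  next
    case True
    then have le: "tree_diam m i j \<le> X n" "\<forall>(m', i', j') \<in> T. tree_diam m i j \<le> tree_diam m' i' j'"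
      using best'(4,5) True by (auto dest!: bspec)
    have s': "s' = run query (locate_center Xa Xb)
        ((fst s)(6 := int i, 7 := int j), g(7 := tree_diam m i j))"
      unfolding s'_def try_edge_def using True measure g g_old[of 7] s neq by simp
    obtain new y where
      "s' = ((fst s)(6 := int i, 7 := int j, 8 := new), g(7 := tree_diam m i j, 8 := y))"
      "covers (new = 1) i j y (tree_diam m i j / 2)"
      using run_locate_center[OF _ _ _ _ _ _ _ _ _ ij, of "g(7 := tree_diam m i j)" Xa Xb] g neq
      unfolding s' A_def B_def by force
    then show ?thesis using le g_old unfolding best_among_def by auto
  qed
  then show "best_among (insert (m, i, j) T) s'" "\<And>k. k < 6 \<Longrightarrow> fst s' k = fst s k"
    "\<And>k. k < 7 \<Longrightarrow> snd s' k = snd s k" by auto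
qed

lemma run_try_edges:
  assumes pos: "position p q m s" and ahead: "fst s 4 = int p'" "snd s 5 = X p'"
      "fst s 5 = int q'" "snd s 6 = X q'"
    and m: "m < n" "p' \<le> m" "m < q" "m < q'" "q' \<le> n" "1 \<le> p'"
    and best: "best_among T s"
  defines "s' \<equiv> run query try_edges s"
  shows "best_among ({(m, p, q), (m, p', q), (m, p, q'), (m, p', q')} \<union> T) s'"
    "position p q m s'"
proof -
  define s1 where "s1 = run query (try_edge 1 1 2 2) s"
  define s2 where "s2 = run query (try_edge 4 5 2 2) s1"
  define s3 where "s3 = run query (try_edge 1 1 5 6) s2"
  define s4 where "s4 = run query (try_edge 4 5 5 6) s3"
  note pos = pos[unfolded position_def] ahead
  have 1: "best_among (insert (m, p, q) T) s1" "\<And>k. k < 6 \<Longrightarrow> fst s1 k = fst s k"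
    "\<And>k. k < 7 \<Longrightarrow> snd s1 k = snd s k"
    using run_try_edge[of 1 2 1 2 s p q m T, folded s1_def] pos m best by simp_all
  have 2: "best_among (insert (m, p', q) (insert (m, p, q) T)) s2"
    "\<And>k. k < 6 \<Longrightarrow> fst s2 k = fst s k" "\<And>k. k < 7 \<Longrightarrow> snd s2 k = snd s k"
    using run_try_edge[of 4 2 5 2 s1 p' q m, folded s2_def, OF _ _ _ _ _ _ _ _ _ _ _ _ _ _ _ 1(1)]
      pos m 1(2,3) by simp_all
  have 3: "best_among (insert (m, p, q') (insert (m, p', q) (insert (m, p, q) T))) s3"
    "\<And>k. k < 6 \<Longrightarrow> fst s3 k = fst s k" "\<And>k. k < 7 \<Longrightarrow> snd s3 k = snd s k"
    using run_try_edge[of 1 5 1 6 s2 p q' m, folded s3_def, OF _ _ _ _ _ _ _ _ _ _ _ _ _ _ _ 2(1)]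
      pos m 2(2,3) by simp_all
  have 4: "best_among (insert (m, p', q') (insert (m, p, q')
      (insert (m, p', q) (insert (m, p, q) T)))) s4"
    "\<And>k. k < 6 \<Longrightarrow> fst s4 k = fst s k" "\<And>k. k < 7 \<Longrightarrow> snd s4 k = snd s k"
    using run_try_edge[of 4 5 5 6 s3 p' q' m, folded s4_def, OF _ _ _ _ _ _ _ _ _ _ _ _ _ _ _ 3(1)]
      pos m 3(2,3) by simp_all
  have s': "s' = s4"
    unfolding s'_def try_edges_def s1_def s2_def s3_def s4_def by simp
  show "best_among ({(m, p, q), (m, p', q), (m, p, q'), (m, p', q')} \<union> T) s'"
    using 4(1) unfolding s' by (simp add: insert_commute)
  show "position p q m s'" using pos 4(2,3) unfolding s' position_def by simp
qed

lemma run_look_ahead: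
  assumes pos: "position p q m s" and best: "best_among T s"
  defines "s' \<equiv> run query look_ahead s"
    and "p' \<equiv> if p < m then Suc p else p" and "q' \<equiv> if q < n then Suc q else q"
  shows "position p q m s'" "best_among T s'" "fst s' 4 = int p'" "snd s' 5 = X p'"
      "fst s' 5 = int q'" "snd s' 6 = X q'"
proof -
  have s': "s' = ((fst s)(4 := int p', 5 := int q'), (snd s)(5 := X p', 6 := X q'))"
    using pos X_Suc[of p] X_Suc[of q] query_Suc[of p] query_Suc[of q]
    unfolding s'_def p'_def q'_def look_ahead_def position_def by (simp add: add.commute)
  show "position p q m s'" using pos unfolding position_def s' by simp
  show "best_among T s'" using best unfolding best_among_def s' by simp
  show "fst s' 4 = int p'" "snd s' 5 = X p'" "fst s' 5 = int q'" "snd s' 6 = X q'"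
    unfolding s' by simp_all
qed

definition trees_upto :: "nat \<Rightarrow> (nat \<times> nat \<times> nat) set" where
  "trees_upto m = {(m', i, j). m' < m \<and> 1 \<le> i \<and> i \<le> m' \<and> m' < j \<and> j \<le> n}"

text \<open>The left end is moved to a candidate first, and the right end is then moved with that
  candidate fixed, so the four combinations dominate all edges for this m.\<close>

lemma best_among_trees_upto_Suc:
  assumes best: "best_among ({(m, p, q), (m, p', q), (m, p, q'), (m, p', q')} \<union> trees_upto m) s"
    and p: "1 \<le> p" "p \<le> m" "2 * X p \<le> X m" "p' = (if p < m then Suc p else p)"
      "p < m \<Longrightarrow> X m < 2 * X p'"
    and q: "m < q" "q \<le> n" "2 * X q \<le> X n + X (Suc m)" "q' = (if q < n then Suc q else q)"
      "q < n \<Longrightarrow> X n + X (Suc m) < 2 * X q'"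
  shows "best_among (trees_upto (Suc m)) s"
proof -
  have le: "snd s 7 \<le> tree_diam m i j" if ij: "1 \<le> i" "i \<le> m" "m < j" "j \<le> n" for i j
  proof -
    have cand: "snd s 7 \<le> tree_diam m p q" "snd s 7 \<le> tree_diam m p' q"
      "snd s 7 \<le> tree_diam m p q'" "snd s 7 \<le> tree_diam m p' q'"
      using best unfolding best_among_def by auto
    obtain i' where i': "i' = p \<or> i' = p'" "tree_diam m i' j \<le> tree_diam m i j"
      using left_candidate[OF ij p] by blast
    have "1 \<le> i'" "i' \<le> m" using i' p by (auto split: if_splits)
    then obtain j' where "j' = q \<or> j' = q'" "tree_diam m i' j' \<le> tree_diam m i' j"
      using right_candidate[OF _ _ ij(3,4) q] by blast
    then show ?thesis using cand i' by auto
  qed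
  then show ?thesis
    using best unfolding best_among_def trees_upto_def by (auto simp: less_Suc_eq)
qed

definition search_inv :: "state \<Rightarrow> bool" where
  "search_inv s \<longleftrightarrow> (\<exists>p q m. position p q m s \<and> best_among (trees_upto m) s)"

definition search_potential :: "state \<Rightarrow> nat" where
  "search_potential s = nat (3 * int n - fst s 1 - fst s 2 - fst s 3)"

lemma search_potential_eq:
  "position p q m s \<Longrightarrow> search_potential s = 3 * n - p - q - m"
  unfolding search_potential_def position_def by auto

lemma run_search_step:
  assumes "search_inv s" "bval query more_m s"
  shows "search_inv (run query search_step s)
    \<and> search_potential (run query search_step s) < search_potential s"
proof -
  obtain p q m where pos: "position p q m s" and best: "best_among (trees_upto m) s"
    using assms unfolding search_inv_def by blast
  define p' where "p' = (if p < m then Suc p else p)"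
  define q' where "q' = (if q < n then Suc q else q)"
  define t where "t = run query look_ahead s"
  note t = run_look_ahead[OF pos best, folded p'_def q'_def t_def]
  note t_pos = t(1)[unfolded position_def]
  have mn: "m < n" using assms(2) pos unfolding position_def by simp
  consider (p) "p < m" "2 * X p' \<le> X m"
    | (q) "p < m \<longrightarrow> X m < 2 * X p'" "q < n" "2 * X q' \<le> X n + X (Suc m)"
    | (m) "p < m \<longrightarrow> X m < 2 * X p'" "q < n \<longrightarrow> X n + X (Suc m) < 2 * X q'"
    by linarith
  then show ?thesis
  proof cases
    case p
    then have step: "run query search_step s = ((fst t)(1 := int p'), (snd t)(1 := X p'))"
      using t mn t_pos unfolding search_step_def t_def[symmetric] by (simp add: t_def[symmetric])
    have pos': "position p' q m (run query search_step s)"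
      using p t_pos unfolding step position_def p'_def by auto
    moreover have "best_among (trees_upto m) (run query search_step s)"
      using t(2) unfolding step best_among_def by simp
    ultimately show ?thesis
      using p pos search_potential_eq[OF pos] search_potential_eq[OF pos'] pos'
      unfolding search_inv_def p'_def by (auto simp: position_def[of p q m s])
  next
    case q
    then have step: "run query search_step s = ((fst t)(2 := int q'), (snd t)(2 := X q'))"
      using t mn t_pos unfolding search_step_def by (auto simp: t_def[symmetric])
    have pos': "position p q' m (run query search_step s)"
      using q t_pos unfolding step position_def q'_def by auto
    moreover have "best_among (trees_upto m) (run query search_step s)"
      using t(2) unfolding step best_among_def by simp
    ultimately show ?thesis
      using q pos search_potential_eq[OF pos] search_potential_eq[OF pos'] pos'
      unfolding search_inv_def q'_def by (auto simp: position_def[of p q m s])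
  next
    case m
    define u where "u = run query try_edges t"
    have step: "run query search_step s = run query next_m u"
      using m t mn t_pos unfolding search_step_def u_def by (auto simp: t_def[symmetric])
    \<comment> \<open>If q = m, then q' = m + 1 and 2 * X (m + 1) \<le> X n + X (m + 1), so q could
      still advance.\<close>
    have "q \<noteq> m" using m(2) mn X_le_last[of "Suc m"] unfolding q'_def by auto
    then have q: "m < q" using t_pos by simp
    have "p' \<le> m" "m < q'" "q' \<le> n" "1 \<le> p'"
      using q t_pos unfolding p'_def q'_def by auto
    note u = run_try_edges[OF t(1,3-6) mn this(1) q this(2-4) t(2), folded u_def]
    note u_pos = u(2)[unfolded position_def]
    have "best_among (trees_upto (Suc m)) u"
      by (rule best_among_trees_upto_Suc[OF u(1) _ _ _ p'_def _ q _ _ q'_def])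
        (use m u_pos mn in auto)
    moreover have next_u: "run query next_m u = ((fst u)(3 := int (Suc m)),
        (snd u)(3 := X (Suc m), 4 := X (Suc m) + query (int (Suc m)) (int (Suc m) + 1)))"
      using u_pos mn unfolding next_m_def by (simp add: add.commute)
    ultimately have "best_among (trees_upto (Suc m)) (run query search_step s)"
      unfolding step best_among_def by simp
    \<comment> \<open>The bounds on X p and X q survive because X m and X (Suc m) only grow; q \<ge>
      Suc m follows from q > m.\<close>
    moreover have pos': "position p q (Suc m) (run query search_step s)"
    proof -
      have "query (int (Suc m)) (int (Suc m) + 1) = d (Suc m) (Suc (Suc m))" if "Suc m < n"
        using query_Suc(1)[of "Suc m"] that by simp
      then show ?thesis
        using u_pos mn q X_Suc[of "Suc m"] X_mono[of m "Suc m"] X_mono[of "Suc m" "Suc (Suc m)"]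
          X_le_last[of "Suc m"]
        unfolding step next_u position_def by auto
    qed
    ultimately show ?thesis
      using pos mn q search_potential_eq[OF pos] search_potential_eq[OF pos'] pos'
      unfolding search_inv_def by (auto simp: position_def[of p q m s])
  qed
qed

definition point_of :: "state \<Rightarrow> gpoint" where
  "point_of s = (nat (fst s 1), nat (fst s 2), snd s 1)"

text \<open>A center on the new edge is already complete before the walk; one on P is still being
  located, with v_a the vertex reached so far.\<close>

definition walk_inv :: "state \<Rightarrow> bool" where
  "walk_inv s \<longleftrightarrow> fst s 0 = int n \<and> best_among (trees_upto n) s \<and>
     (if fst s 8 = 1 then 0 \<le> fst s 1 \<and> 0 \<le> fst s 2
        \<and> is_point n d (nat (fst s 6)) (nat (fst s 7)) (point_of s)
        \<and> ecc n d (nat (fst s 6)) (nat (fst s 7)) (point_of s) \<le> snd s 7 / 2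
      else \<exists>a. fst s 1 = int a \<and> snd s 1 = X a \<and> 1 \<le> a \<and> a \<le> n \<and> X a \<le> snd s 8)"

lemma run_start_walk:
  assumes "search_inv s" "\<not> bval query more_m s"
  shows "walk_inv (run query start_walk s)"
proof -
  obtain p q m where pos: "position p q m s" and best: "best_among (trees_upto m) s"
    using assms unfolding search_inv_def by blast
  have best: "best_among (trees_upto n) s" and n0: "fst s 0 = int n"
    using pos best assms(2) unfolding position_def by (cases "m = n"; simp)+
  then obtain i j where ij: "fst s 6 = int i" "fst s 7 = int j"
      and cov: "covers (fst s 8 = 1) i j (snd s 8) (snd s 7 / 2)"
    unfolding best_among_def by blast
  define t where "t = run query start_walk s"
  have "fst t k = fst s k" if "k \<noteq> 1" "k \<noteq> 2" for k
    using that unfolding t_def start_walk_def by simp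
  moreover have "snd t k = snd s k" if "k \<noteq> 1" for k
    using that unfolding t_def start_walk_def by simp
  ultimately have "best_among (trees_upto n) t" "fst t 0 = int n"
    using best n0 unfolding best_among_def by simp_all
  moreover have "if fst t 8 = 1 then 0 \<le> fst t 1 \<and> 0 \<le> fst t 2
        \<and> is_point n d (nat (fst t 6)) (nat (fst t 7)) (point_of t)
        \<and> ecc n d (nat (fst t 6)) (nat (fst t 7)) (point_of t) \<le> snd t 7 / 2
      else \<exists>a. fst t 1 = int a \<and> snd t 1 = X a \<and> 1 \<le> a \<and> a \<le> n \<and> X a \<le> snd t 8"
  proof (cases "fst s 8 = 1")
    case True
    then have cov: "covers True i j (snd s 8) (snd s 7 / 2)" using cov by simp
    then have "1 \<le> i" "i \<le> n" "1 \<le> j" "j \<le> n" unfolding covers_def by auto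
    then have "query (int i) (int j) = d i j" by simp
    then show ?thesis
      using ecc_edge_center[OF cov] True ij
      unfolding t_def start_walk_def point_of_def by auto
  next
    case False
    then have "0 \<le> snd s 8" using cov unfolding covers_def by simp
    then show ?thesis
      using False n_pos unfolding t_def start_walk_def by (auto intro!: exI[of _ 1])
  qed
  ultimately show ?thesis unfolding walk_inv_def t_def by blast
qed

lemma run_walk_step:
  assumes inv: "walk_inv s" and more: "bval query more_walk s"
  shows "walk_inv (run query walk_step s)
    \<and> nat (int n - fst (run query walk_step s) 1) < nat (int n - fst s 1)"
proof -
  have "fst s 8 \<noteq> 1" using more by simp
  then obtain a where a: "fst s 1 = int a" "snd s 1 = X a" "1 \<le> a" "a \<le> n" "X a \<le> snd s 8"
    and n0: "fst s 0 = int n" and best: "best_among (trees_upto n) s"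
    using inv unfolding walk_inv_def by auto
  have lt: "a < n" and next_le: "X (Suc a) \<le> snd s 8"
    using more a n0 X_Suc[of a] query_Suc[of a] by auto
  have step: "run query walk_step s = ((fst s)(1 := int (Suc a)), (snd s)(1 := X (Suc a)))"
    using a lt X_Suc[of a] query_Suc[of a] unfolding walk_step_def by (simp add: add.commute)
  have "best_among (trees_upto n) (run query walk_step s)"
    using best unfolding best_among_def step by simp
  then have "walk_inv (run query walk_step s)"
    using \<open>fst s 8 \<noteq> 1\<close> n0 lt next_le unfolding walk_inv_def step
    by (auto intro!: exI[of _ "Suc a"])
  then show ?thesis using lt a unfolding step by simp
qed

lemma run_write_output:
  assumes inv: "walk_inv s" and stop: "\<not> bval query more_walk s"
  shows "correct_output n d (run query write_output s)"
proof -
  obtain i j where ij: "fst s 6 = int i" "fst s 7 = int j"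
    and cov: "covers (fst s 8 = 1) i j (snd s 8) (snd s 7 / 2)" and le: "snd s 7 \<le> X n"
      "\<forall>(m', i', j') \<in> trees_upto n. snd s 7 \<le> tree_diam m' i' j'"
    using inv unfolding walk_inv_def best_among_def by blast
  have range: "1 \<le> i" "i \<le> j" "j \<le> n" using cov unfolding covers_def by auto
  have tree: "2 * (snd s 7 / 2) \<le> tree_diam m' i' j'"
    if "1 \<le> i'" "i' \<le> m'" "m' < j'" "j' \<le> n" for m' i' j'
    using le(2) that unfolding trees_upto_def by auto
  define t where "t = run query write_output s"
  have "0 \<le> fst t 2 \<and> 0 \<le> fst t 3 \<and> is_point n d i j (nat (fst t 2), nat (fst t 3), snd t 1)
      \<and> ecc n d i j (nat (fst t 2), nat (fst t 3), snd t 1) \<le> snd s 7 / 2"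
  proof (cases "fst s 8 = 1")
    case True
    then show ?thesis
      using inv ij unfolding walk_inv_def point_of_def t_def write_output_def by simp
  next
    case False
    then obtain a where a: "fst s 1 = int a" "snd s 1 = X a" "1 \<le> a" "a \<le> n" "X a \<le> snd s 8"
      and n0: "fst s 0 = int n"
      using inv unfolding walk_inv_def by auto
    have "a = n \<or> snd s 8 < X (Suc a)"
      using stop False a n0 X_Suc[of a] query_Suc[of a] by (cases "a = n") auto
    moreover have "covers False i j (snd s 8) (snd s 7 / 2)" using cov False by simp
    ultimately show ?thesis
      using ecc_path_center[of i j "snd s 8" "snd s 7 / 2" a] a False
      unfolding t_def write_output_def by (simp add: nat_add_distrib)
  qed
  note center = this
  have "2 * (snd s 7 / 2) \<le> X n" using le(1) by simp
  note opt = optimal_center[OF range _ _ this tree, of "(nat (fst t 2), nat (fst t 3), snd t 1)"]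
  have opt: "radius n d i j = snd s 7 / 2"
      "is_center n d i j (nat (fst t 2), nat (fst t 3), snd t 1)"
      "\<And>i' j'. 1 \<le> i' \<Longrightarrow> i' \<le> j' \<Longrightarrow> j' \<le> n \<Longrightarrow> snd s 7 / 2 \<le> radius n d i' j'"
    using opt center by blast+
  have "fst t 0 = int i" "fst t 1 = int j" "snd t 0 = snd s 7 / 2"
    using ij unfolding t_def write_output_def by simp_all
  then have "correct_output n d t"
    using center opt range unfolding correct_output_def Let_def by (simp add: opt(1))
  then show ?thesis unfolding t_def .
qed

text \<open>The state is given exactly, since \<open>start_search\<close> relies on untouched
  registers being 0.\<close>

definition length_inv :: "state \<Rightarrow> bool" where
  "length_inv s \<longleftrightarrow> (\<exists>m. 1 \<le> m \<and> m \<le> n \<and>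
     s = ((\<lambda>_. 0)(0 := int n, 3 := int m), (\<lambda>_. 0)(0 := X m)))"

lemma run_length_step:
  assumes "length_inv s" "bval query more_m s"
  shows "length_inv (run query length_step s)
    \<and> nat (int n - fst (run query length_step s) 3) < nat (int n - fst s 3)"
proof -
  obtain m where m: "1 \<le> m" "m < n" and
    s: "s = ((\<lambda>_. 0)(0 := int n, 3 := int m), (\<lambda>_. 0)(0 := X m))"
    using assms unfolding length_inv_def by auto
  have step: "run query length_step s
      = ((\<lambda>_. 0)(0 := int n, 3 := int (Suc m)), (\<lambda>_. 0)(0 := X (Suc m)))"
    using m X_Suc[of m] query_Suc[of m] unfolding s length_step_def by (simp add: add.commute)
  have "length_inv (run query length_step s)"
    using m unfolding step length_inv_def by (intro exI[of _ "Suc m"]) simp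
  moreover have "fst s 3 = int m" using s by simp
  ultimately show ?thesis using m unfolding step by simp
qed

lemma run_start_search:
  assumes "length_inv s" "\<not> bval query more_m s"
  shows "search_inv (run query start_search s)"
proof -
  have s: "s = ((\<lambda>_. 0)(0 := int n, 3 := int n), (\<lambda>_. 0)(0 := X n))"
    using assms unfolding length_inv_def by auto
  have X: "0 \<le> X n" "X (Suc 1) = d 1 (Suc 1)" "1 < n \<longrightarrow> 0 \<le> d 1 (Suc 1)"
    using X_nonneg[of n] n_pos X_Suc[of 1] d_nonneg[of 1 "Suc 1"] by auto
  have "query 1 2 = d 1 (Suc 1)" if "1 < n"
    using query_Suc(1)[of 1] that by simp
  then have "position 1 1 1 (run query start_search s)"
    using X n_pos unfolding position_def s start_search_def by simp
  moreover have "best_among (trees_upto 1) (run query start_search s)"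
    unfolding best_among_def trees_upto_def s start_search_def
    using covers_path by (auto intro!: exI[of _ 1])
  ultimately show ?thesis unfolding search_inv_def by blast
qed

end

section \<open>Linear running time, with a constant independent of n and the metric\<close>

lemma triple_program:
  assumes "1 \<le> n" "is_finite_metric n d"
  shows "triple (dist_oracle n d) n (\<lambda>s. s = init n) program program_cost (correct_output n d)"
proof -
  interpret metric_path n d using assms by unfold_locales
  show ?thesis
    unfolding program_def program_cost_def
  proof (intro triple_Seq)
    show "triple query n (\<lambda>s. s = init n) (iset m_reg (N 1)) (max_steps (iset m_reg (N 1))) length_inv"
      using n_pos by (intro triple_loop_free)
        (auto simp: length_inv_def init_def intro!: exI[of _ 1])
    show "triple query n length_inv (While more_m length_step) (Suc (max_steps length_step) * 1 + 1)
        (\<lambda>s. length_inv s \<and> \<not> bval query more_m s)"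
      by (rule triple_While[where \<mu> = "\<lambda>s. nat (int n - fst s 3)",
            OF loop_free_steps(1) n_pos run_length_step])
        (auto simp: length_inv_def)
    show "triple query n (\<lambda>s. length_inv s \<and> \<not> bval query more_m s) start_search
        (max_steps start_search) search_inv"
      using loop_free_steps n_pos run_start_search by (intro triple_loop_free) auto
    show "triple query n search_inv (While more_m search_step) (Suc (max_steps search_step) * 3 + 1)
        (\<lambda>s. search_inv s \<and> \<not> bval query more_m s)"
      by (rule triple_While[where \<mu> = search_potential,
            OF loop_free_steps(3) n_pos run_search_step])
        (auto simp: search_inv_def search_potential_eq)
    show "triple query n (\<lambda>s. search_inv s \<and> \<not> bval query more_m s) start_walk
        (max_steps start_walk) walk_inv"
      using loop_free_steps n_pos run_start_walk by (intro triple_loop_free) auto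
    show "triple query n walk_inv (While more_walk walk_step) (Suc (max_steps walk_step) * 1 + 1)
        (\<lambda>s. walk_inv s \<and> \<not> bval query more_walk s)"
      by (rule triple_While[where \<mu> = "\<lambda>s. nat (int n - fst s 1)",
            OF loop_free_steps(5) n_pos run_walk_step])
        (auto simp: walk_inv_def split: if_splits)
    show "triple query n (\<lambda>s. walk_inv s \<and> \<not> bval query more_walk s) write_output
        (max_steps write_output) (correct_output n d)"
      using loop_free_steps n_pos run_write_output by (intro triple_loop_free) auto
  qed
qed

theorem theorem1:
  "\<exists>(P :: com) (C :: nat). \<forall>n d. n \<ge> 1 \<and> is_finite_metric n d \<longrightarrow>
     (\<exists>k s. exec (dist_oracle n d) P (init n) k s \<and> k \<le> C * n \<and> correct_output n d s)"
  using triple_program unfolding triple_def by blast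

end
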